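(* Let $\Gamma$ be a (finitely generated) recursively presented self-simulable group. Then every recursively presented algebraic action of $\Gamma$ is the topological factor of some $\Gamma$-subshift of finite type.
   Context: r.e. means recursively enumerable. For a finite symmetric generating set $S$ of a group $\Gamma$ and $w\in S^*$, $\underline w\in\Gamma$ is the element represented by $w$. A finitely generated group is recursively presented if for some (equivalently, any) such $S$ the set $\{w\in S^*:\underline w=1_\Gamma\}$ is r.e. Algebraic actions. An algebraic action is an action $\Gamma\curvearrowright X$ by continuous automorphisms of a compact metrizable abelian group $X$; its Pontryagin dual $\widehat X$ is a left $\mathbb Z[\Gamma]$-module via $(g\cdot\chi)(x)=\chi(g^{-1}x)$, and the action is finitely generated if this module is finitely generated. For $p=\sum_{i}c_ig_i\in\mathbb Z[\Gamma]$ (a finite formal sum) put $p^*=\sum_i c_ig_i^{-1}$; for $x\in(\mathbb R/\mathbb Z)^\Gamma$, $xp^*\in(\mathbb R/\mathbb Z)^\Gamma$ is given by $(xp^* )(h)=\sum_i c_i\,x(hg_i) \bmod \mathbb Z$. Let $\mathbb Z[S^*]$ be the set of finitely supported maps $p\colon S^*\to\mathbb Z$, and for such $p$ put $\underline p=\sum_{w\in\operatorname{supp}(p)}p(w)\underline w\in\mathbb Z[\Gamma]$. A finitely generated algebraic action $\Gamma\curvearrowright X$ is recursively presented if there are $n\in\mathbb N$ and a total computable map $g\colon\mathbb N\to\mathbb Z[S^*]^n$ such that, up to isomorphism, the action is the shift action $(\gamma\cdot x)(h)=x(\gamma^{-1}h)$ (applied coordinatewise) on $$\Big\{(x_1,\dots,x_n)\in((\mathbb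 R/\mathbb Z)^\Gamma)^n:\ \sum_{i=1}^n x_i\,\underline{g(k)_i}^*=0\ \text{ for every }k\in\mathbb N\Big\}.$$ Cantor space. For $w\in\{0,1\}^*$, $[w]$ is the set of sequences in $\{0,1\}^{\mathbb N}$ with prefix $w$. A set is effectively open if it equals $\bigcup_{w\in L}[w]$ for some r.e. $L\subset\{0,1\}^*$; effectively closed sets are complements of effectively open sets. A map $f\colon X\to\{0,1\}^{\mathbb{N}}$, $X\subset\{0,1\}^{\mathbb N}$, is computable if, uniformly in $w$, there is an effectively open $U_w$ with $f^{-1}([w])=U_w\cap X$. An action of a finitely generated group on $X\subset\{0,1\}^{\mathbb N}$ is computable if for some (equivalently any) finite generating set each generator acts by a computable map. A finitely generated group $\Gamma$ is self-simulable if for every effectively closed $X\subset\{0,1\}^{\mathbb N}$ and every computable action $\Gamma\curvearrowright X$ there is a $\Gamma$-SFT $Y$ such that $\Gamma\curvearrowright X$ is a topological factor of $\Gamma\curvearrowright Y$. For a finite alphabet $A$, $\Gamma$ acts on $A^\Gamma$ by $(gx)(h)=x(g^{-1}h)$. For a pattern $p\in A^F$, $F\subset\Gamma$ finite, $[p]=\{x\in A^\Gamma:x|_F=p\}$. A $\Gamma$-SFT (subshift of finite type) is a set $\{x\in A^\Gamma: gx\notin[p]\ \forall g\in\Gamma, p\in\mathcal F\}$ with $\mathcal F$ a finite set of patterns. $\Gamma\curvearrowright Y$ is a topological factor of $\Gamma\curvearrowright X$ if there is a continuous surjective $\Gamma$-equivariant map $X\to Y$. *)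

theory Defs
  imports
    "HOL-Analysis.Analysis"
    "HOL-Algebra.Generated_Groups"
    "HOL-Algebra.Group_Action"
    "HOL-Library.Nat_Bijection"
    "HOL-Library.Poly_Mapping"
begin

section \<open>Recursive functions and recursively enumerable sets\<close>

text \<open>
  Kleene's partial recursive functions, with an explicit syntax and a big-step semantics.
  The semantics is not arity-checked: an ill-formed application just has no value, and a
  function may ignore surplus arguments. For every fixed number of arguments the functions obtained
  are exactly the partial recursive ones.
\<close>

datatype recf =
    Zero
  | Succ
  | Proj nat
  | Comp recf "recf list"
  | Prec recf recf
  | Mu recf

inductive computes :: "recf \<Rightarrow> nat list \<Rightarrow> nat \<Rightarrow> bool" where
  zero: "computes Zero xs 0"
| succ: "computes Succ (x # xs) (Suc x)"
| proj: "i < length xs \<Longrightarrow> computes (Proj i) xs (xs ! i)"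
| comp: "list_all2 (\<lambda>g y. computes g xs y) gs ys \<Longrightarrow> computes f ys z \<Longrightarrow>
          computes (Comp f gs) xs z"
| prec_0: "computes f xs y \<Longrightarrow> computes (Prec f g) (0 # xs) y"
| prec_Suc: "computes (Prec f g) (n # xs) r \<Longrightarrow> computes g (n # r # xs) y \<Longrightarrow>
          computes (Prec f g) (Suc n # xs) y"
| mu: "computes f (n # xs) 0 \<Longrightarrow> (\<And>m. m < n \<Longrightarrow> \<exists>y. computes f (m # xs) (Suc y)) \<Longrightarrow>
          computes (Mu f) xs n"
monos list.rel_mono

lemma computes_deterministic: "computes f xs y \<Longrightarrow> computes f xs z \<Longrightarrow> y = z"
proof (induction f xs y arbitrary: z rule: computes.induct)
  case (zero xs)
  then show ?case by cases simp
next
  case (succ x xs)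
  then show ?case by cases simp
next
  case (proj i xs)
  from proj.prems show ?case by cases simp
next
  case (comp xs gs ys f y)
  from comp.prems obtain ys' where ys':
    "list_all2 (\<lambda>g y. computes g xs y) gs ys'" "computes f ys' z"
    by cases (rule that)
  have "ys = ys'"
  proof (rule nth_equalityI)
    show len: "length ys = length ys'"
      using list_all2_lengthD[OF comp.IH(1)] list_all2_lengthD[OF ys'(1)] by (rule trans[OF sym])
    fix i assume "i < length ys"
    then have i: "i < length gs" "i < length ys'"
      using list_all2_lengthD[OF comp.IH(1)] len by auto
    show "ys ! i = ys' ! i"
      using list_all2_nthD[OF comp.IH(1) i(1)] list_all2_nthD[OF ys'(1) i(1)] by blast
  qed
  then show ?case using comp.IH(2) ys'(2) by simp
next
  case (prec_0 f xs y g)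
  from prec_0.prems have "computes f xs z" by cases
  then show ?case by (rule prec_0.IH)
next
  case (prec_Suc f g n xs r y)
  from prec_Suc.prems obtain r' where r': "computes (Prec f g) (n # xs) r'"
      "computes g (n # r' # xs) z"
    by cases (rule that)
  have "r = r'" by (rule prec_Suc.IH(1)[OF r'(1)])
  then show ?case using prec_Suc.IH(2) r'(2) by simp
next
  case (mu f n xs)
  from mu.prems have z0: "computes f (z # xs) 0" by cases
  from mu.prems have z: "\<exists>y. computes f (m # xs) (Suc y)" if "m < z" for m
    by cases (use that in blast)
  show ?case
  proof (rule linorder_cases[of n z])
    assume "n < z"
    then obtain y where "computes f (n # xs) (Suc y)" using z by blast
    then show ?thesis using mu.IH(1) by blast
  next
    assume "z < n"
    then show ?thesis using mu.IH(2) z0 by blast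
  qed
qed

definition total_computable :: "(nat \<Rightarrow> nat) \<Rightarrow> bool" where
  "total_computable g \<longleftrightarrow> (\<exists>f. \<forall>k. computes f [k] (g k))"

definition re :: "nat set \<Rightarrow> bool" where
  "re A \<longleftrightarrow> (\<exists>f. A = {k. \<exists>y. computes f [k] y})"


section \<open>Finitely generated and recursively presented groups\<close>

definition finitely_generated_group :: "('g, 'm) monoid_scheme \<Rightarrow> bool" where
  "finitely_generated_group G \<longleftrightarrow>
     group G \<and> (\<exists>S. finite S \<and> S \<subseteq> carrier G \<and> generate G S = carrier G)"

text \<open>
  A finite symmetric generating set \<open>S\<close> is given by an enumeration \<open>s\<close> without repetitions. Words
  over \<open>S\<close> are then lists of indices into \<open>s\<close>, and computability on words is
  computability on their codes \<^const>\<open>list_encode\<close>.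
\<close>

definition symmetric_generating :: "('g, 'm) monoid_scheme \<Rightarrow> 'g list \<Rightarrow> bool" where
  "symmetric_generating G s \<longleftrightarrow>
     distinct s \<and> set s \<subseteq> carrier G \<and> (\<forall>a\<in>set s. inv\<^bsub>G\<^esub> a \<in> set s) \<and>
     generate G (set s) = carrier G"

definition words :: "'g list \<Rightarrow> nat list set" where
  "words s = lists {..<length s}"

definition word_value :: "('g, 'm) monoid_scheme \<Rightarrow> 'g list \<Rightarrow> nat list \<Rightarrow> 'g" where
  "word_value G s w = foldr (\<lambda>i a. s ! i \<otimes>\<^bsub>G\<^esub> a) w \<one>\<^bsub>G\<^esub>"

definition recursively_presented_group :: "('g, 'm) monoid_scheme \<Rightarrow> bool" where
  "recursively_presented_group G \<longleftrightarrow>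
     finitely_generated_group G \<and>
     (\<exists>s. symmetric_generating G s \<and>
          re (list_encode ` {w \<in> words s. word_value G s w = \<one>\<^bsub>G\<^esub>}))"


section \<open>Topological factors and subshifts of finite type\<close>

definition topological_factor ::
    "('g, 'm) monoid_scheme \<Rightarrow> 'y topology \<Rightarrow> ('g \<Rightarrow> 'y \<Rightarrow> 'y) \<Rightarrow>
     'x topology \<Rightarrow> ('g \<Rightarrow> 'x \<Rightarrow> 'x) \<Rightarrow> bool" where
  \<comment> \<open>the action on \<open>X\<close> is a factor of the action on \<open>Y\<close>\<close>
  "topological_factor G Y actY X actX \<longleftrightarrow>
     (\<exists>\<pi>. continuous_map Y X \<pi> \<and> \<pi> ` topspace Y = topspace X \<and>
          (\<forall>g\<in>carrier G. \<forall>y\<in>topspace Y. \<pi> (actY g y) = actX g (\<pi> y)))"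

definition shift :: "('g, 'm) monoid_scheme \<Rightarrow> 'g \<Rightarrow> ('g \<Rightarrow> 'b) \<Rightarrow> ('g \<Rightarrow> 'b)" where
  "shift G g x = (\<lambda>h\<in>carrier G. x (inv\<^bsub>G\<^esub> g \<otimes>\<^bsub>G\<^esub> h))"

definition full_shift :: "('g, 'm) monoid_scheme \<Rightarrow> 'b set \<Rightarrow> ('g \<Rightarrow> 'b) topology" where
  "full_shift G A = product_topology (\<lambda>_. discrete_topology A) (carrier G)"

text \<open>A pattern with support \<open>F\<close> is a pair \<open>(F, p)\<close> with \<open>p \<in> F \<rightarrow>\<^sub>E A\<close>.\<close>

definition pattern_cylinder ::
    "('g, 'm) monoid_scheme \<Rightarrow> 'b set \<Rightarrow> 'g set \<times> ('g \<Rightarrow> 'b) \<Rightarrow> ('g \<Rightarrow> 'b) set" where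
  "pattern_cylinder G A P = {x \<in> carrier G \<rightarrow>\<^sub>E A. restrict x (fst P) = snd P}"

definition SFT :: "('g, 'm) monoid_scheme \<Rightarrow> 'b set \<Rightarrow> ('g \<Rightarrow> 'b) set \<Rightarrow> bool" where
  "SFT G A Y \<longleftrightarrow>
     finite A \<and>
     (\<exists>\<F>. finite \<F> \<and>
          (\<forall>(F, p)\<in>\<F>. finite F \<and> F \<subseteq> carrier G \<and> p \<in> F \<rightarrow>\<^sub>E A) \<and>
          Y = {x \<in> carrier G \<rightarrow>\<^sub>E A.
                 \<forall>g\<in>carrier G. \<forall>P\<in>\<F>. shift G g x \<notin> pattern_cylinder G A P})"

text \<open>Every finite alphabet may be taken to be a set of natural numbers.\<close>

definition factor_of_SFT ::
    "('g, 'm) monoid_scheme \<Rightarrow> 'x topology \<Rightarrow> ('g \<Rightarrow> 'x \<Rightarrow> 'x) \<Rightarrow> bool" where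
  "factor_of_SFT G X act \<longleftrightarrow>
     (\<exists>(A :: nat set) Y. SFT G A Y \<and>
        topological_factor G (subtopology (full_shift G A) Y) (shift G) X act)"


section \<open>Computability on Cantor space and self-simulable groups\<close>

definition cantor_space :: "(nat \<Rightarrow> bool) topology" where
  "cantor_space = product_topology (\<lambda>_. discrete_topology UNIV) UNIV"

definition cylinder :: "bool list \<Rightarrow> (nat \<Rightarrow> bool) set" where
  "cylinder w = {x. \<forall>i<length w. x i = w ! i}"

definition bits_encode :: "bool list \<Rightarrow> nat" where
  "bits_encode w = list_encode (map of_bool w)"

definition effectively_open :: "(nat \<Rightarrow> bool) set \<Rightarrow> bool" where
  "effectively_open U \<longleftrightarrow> (\<exists>L. re (bits_encode ` L) \<and> U = (\<Union>w\<in>L. cylinder w))"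

definition effectively_closed :: "(nat \<Rightarrow> bool) set \<Rightarrow> bool" where
  "effectively_closed X \<longleftrightarrow> effectively_open (- X)"

text \<open>
  Uniformity in \<open>w\<close>: one r.e. set of pairs \<open>(w, u)\<close> enumerates, for all \<open>w\<close> at once, words \<open>u\<close>
  whose cylinders make up the open set \<open>U\<^sub>w\<close>.
\<close>

definition computable_map_on ::
    "(nat \<Rightarrow> bool) set \<Rightarrow> ((nat \<Rightarrow> bool) \<Rightarrow> (nat \<Rightarrow> bool)) \<Rightarrow> bool" where
  "computable_map_on X f \<longleftrightarrow>
     (\<exists>L. re ((\<lambda>(w, u). prod_encode (bits_encode w, bits_encode u)) ` L) \<and>
          (\<forall>w. {x \<in> X. f x \<in> cylinder w} = (\<Union>u\<in>{u. (w, u) \<in> L}. cylinder u) \<inter> X))"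

definition computable_action ::
    "('g, 'm) monoid_scheme \<Rightarrow> (nat \<Rightarrow> bool) set \<Rightarrow>
     ('g \<Rightarrow> (nat \<Rightarrow> bool) \<Rightarrow> (nat \<Rightarrow> bool)) \<Rightarrow> bool" where
  "computable_action G X act \<longleftrightarrow>
     group_action G X act \<and>
     (\<exists>S. finite S \<and> S \<subseteq> carrier G \<and> generate G S = carrier G \<and>
          (\<forall>a\<in>S. computable_map_on X (act a)))"

definition self_simulable :: "('g, 'm) monoid_scheme \<Rightarrow> bool" where
  "self_simulable G \<longleftrightarrow>
     finitely_generated_group G \<and>
     (\<forall>X act. effectively_closed X \<and> computable_action G X act \<longrightarrow>
        factor_of_SFT G (subtopology cantor_space X) act)"


section \<open>The group \<open>\<real>/\<int>\<close>\<close>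

quotient_type rmodz = real / "\<lambda>x y :: real. x - y \<in> \<int>"
proof (rule equivpI)
  show "reflp (\<lambda>x y :: real. x - y \<in> \<int>)"
    by (simp add: reflp_def)
  show "symp (\<lambda>x y :: real. x - y \<in> \<int>)"
  proof (rule sympI)
    fix x y :: real
    assume "x - y \<in> \<int>"
    then have "- (x - y) \<in> \<int>" by (rule Ints_minus)
    then show "y - x \<in> \<int>" by simp
  qed
  show "transp (\<lambda>x y :: real. x - y \<in> \<int>)"
  proof (rule transpI)
    fix x y z :: real
    assume "x - y \<in> \<int>" "y - z \<in> \<int>"
    then have "(x - y) + (y - z) \<in> \<int>" by (rule Ints_add)
    then show "x - z \<in> \<int>" by simp
  qed
qed

instantiation rmodz :: ab_group_add
begin

lift_definition zero_rmodz :: rmodz is "0 :: real" .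

lift_definition plus_rmodz :: "rmodz \<Rightarrow> rmodz \<Rightarrow> rmodz" is "(+)"
proof -
  fix x x' y y' :: real
  assume "x - x' \<in> \<int>" "y - y' \<in> \<int>"
  then have "(x - x') + (y - y') \<in> \<int>" by (rule Ints_add)
  then show "(x + y) - (x' + y') \<in> \<int>" by (simp add: add_diff_add)
qed

lift_definition uminus_rmodz :: "rmodz \<Rightarrow> rmodz" is uminus
proof -
  fix x x' :: real
  assume "x - x' \<in> \<int>"
  then have "- (x - x') \<in> \<int>" by (rule Ints_minus)
  then show "- x - - x' \<in> \<int>" by simp
qed

definition minus_rmodz :: "rmodz \<Rightarrow> rmodz \<Rightarrow> rmodz" where
  "minus_rmodz x y = x + - y"

instance
proof
  fix a b c :: rmodz
  show "a + b + c = a + (b + c)" by transfer simp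
  show "a + b = b + a" by transfer simp
  show "0 + a = a" by transfer simp
  show "- a + a = 0" by transfer simp
  show "a - b = a + - b" by (rule minus_rmodz_def)
qed

end

lift_definition rmodz_scale :: "int \<Rightarrow> rmodz \<Rightarrow> rmodz" is "\<lambda>c x. of_int c * x"
proof -
  fix c :: int and x x' :: real
  assume "x - x' \<in> \<int>"
  then have "of_int c * (x - x') \<in> \<int>" by (intro Ints_mult) auto
  then show "of_int c * x - of_int c * x' \<in> \<int>" by (simp add: right_diff_distrib)
qed

instantiation rmodz :: topological_space
begin

definition open_rmodz :: "rmodz set \<Rightarrow> bool" where
  \<comment> \<open>the quotient topology\<close>
  "open_rmodz U \<longleftrightarrow> open (abs_rmodz -` U)"

instance
  by standard (auto simp: open_rmodz_def vimage_Union)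

end


section \<open>Algebraic actions\<close>

text \<open>
  The compact abelian group is written multiplicatively, with its topology as a separate
  argument. The integral group ring consists of the finitely supported \<open>p :: 'g \<Rightarrow>\<^sub>0 int\<close>
  with support in \<open>carrier G\<close>.
\<close>

definition compact_metrizable_abelian_group :: "('x, 'n) monoid_scheme \<Rightarrow> 'x topology \<Rightarrow> bool" where
  "compact_metrizable_abelian_group X T \<longleftrightarrow>
     comm_group X \<and> topspace T = carrier X \<and> compact_space T \<and> metrizable_space T \<and>
     continuous_map (prod_topology T T) T (\<lambda>(x, y). x \<otimes>\<^bsub>X\<^esub> y) \<and>
     continuous_map T T (\<lambda>x. inv\<^bsub>X\<^esub> x)"

definition algebraic_action ::
    "('g, 'm) monoid_scheme \<Rightarrow> ('x, 'n) monoid_scheme \<Rightarrow> 'x topology \<Rightarrow> ('g \<Rightarrow> 'x \<Rightarrow> 'x) \<Rightarrow> bool" where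
  "algebraic_action G X T act \<longleftrightarrow>
     compact_metrizable_abelian_group X T \<and> group_action G (carrier X) act \<and>
     (\<forall>g\<in>carrier G. act g \<in> iso X X \<and> continuous_map T T (act g))"

definition pontryagin_dual :: "('x, 'n) monoid_scheme \<Rightarrow> 'x topology \<Rightarrow> ('x \<Rightarrow> rmodz) set" where
  "pontryagin_dual X T =
     {\<xi> \<in> extensional (carrier X). continuous_map T euclidean \<xi> \<and>
        (\<forall>x\<in>carrier X. \<forall>y\<in>carrier X. \<xi> (x \<otimes>\<^bsub>X\<^esub> y) = \<xi> x + \<xi> y)}"

definition group_ring :: "('g, 'm) monoid_scheme \<Rightarrow> ('g \<Rightarrow>\<^sub>0 int) set" where
  "group_ring G = {p. Poly_Mapping.keys p \<subseteq> carrier G}"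

definition dual_smult ::
    "('g, 'm) monoid_scheme \<Rightarrow> ('x, 'n) monoid_scheme \<Rightarrow> ('g \<Rightarrow> 'x \<Rightarrow> 'x) \<Rightarrow>
     ('g \<Rightarrow>\<^sub>0 int) \<Rightarrow> ('x \<Rightarrow> rmodz) \<Rightarrow> ('x \<Rightarrow> rmodz)" where
  \<comment> \<open>the \<open>\<int>[\<Gamma>]\<close>-module structure extending \<open>(g \<cdot> \<xi>)(x) = \<xi>(g\<inverse>x)\<close>\<close>
  "dual_smult G X act p \<xi> =
     (\<lambda>x\<in>carrier X. \<Sum>g\<in>Poly_Mapping.keys p.
       rmodz_scale (Poly_Mapping.lookup p g) (\<xi> (act (inv\<^bsub>G\<^esub> g) x)))"

definition finitely_generated_action ::
    "('g, 'm) monoid_scheme \<Rightarrow> ('x, 'n) monoid_scheme \<Rightarrow> 'x topology \<Rightarrow> ('g \<Rightarrow> 'x \<Rightarrow> 'x) \<Rightarrow> bool" where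
  "finitely_generated_action G X T act \<longleftrightarrow>
     (\<exists>B. finite B \<and> B \<subseteq> pontryagin_dual X T \<and>
        (\<forall>\<xi>\<in>pontryagin_dual X T. \<exists>p. (\<forall>\<beta>\<in>B. p \<beta> \<in> group_ring G) \<and>
           \<xi> = (\<lambda>x\<in>carrier X. \<Sum>\<beta>\<in>B. dual_smult G X act (p \<beta>) \<beta> x)))"

definition algebraic_action_iso ::
    "('g, 'm) monoid_scheme \<Rightarrow> ('x, 'n) monoid_scheme \<Rightarrow> 'x topology \<Rightarrow> ('g \<Rightarrow> 'x \<Rightarrow> 'x) \<Rightarrow>
     ('y, 'k) monoid_scheme \<Rightarrow> 'y topology \<Rightarrow> ('g \<Rightarrow> 'y \<Rightarrow> 'y) \<Rightarrow> bool" where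
  "algebraic_action_iso G X T act X' T' act' \<longleftrightarrow>
     (\<exists>\<phi>. \<phi> \<in> iso X X' \<and> homeomorphic_map T T' \<phi> \<and>
          (\<forall>g\<in>carrier G. \<forall>x\<in>carrier X. \<phi> (act g x) = act' g (\<phi> x)))"


section \<open>Recursively presented algebraic actions\<close>

definition star_mult ::
    "('g, 'm) monoid_scheme \<Rightarrow> ('g \<Rightarrow> rmodz) \<Rightarrow> ('g \<Rightarrow>\<^sub>0 int) \<Rightarrow> ('g \<Rightarrow> rmodz)" where
  \<comment> \<open>\<open>x p\<^sup>*\<close>\<close>
  "star_mult G x p = (\<lambda>h\<in>carrier G. \<Sum>g\<in>Poly_Mapping.keys p.
       rmodz_scale (Poly_Mapping.lookup p g) (x (h \<otimes>\<^bsub>G\<^esub> g)))"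

definition word_ring :: "'g list \<Rightarrow> (nat list \<Rightarrow>\<^sub>0 int) set" where
  "word_ring s = {p. Poly_Mapping.keys p \<subseteq> words s}"

definition word_ring_value ::
    "('g, 'm) monoid_scheme \<Rightarrow> 'g list \<Rightarrow> (nat list \<Rightarrow>\<^sub>0 int) \<Rightarrow> ('g \<Rightarrow>\<^sub>0 int)" where
  "word_ring_value G s p =
     (\<Sum>w\<in>Poly_Mapping.keys p. Poly_Mapping.single (word_value G s w) (Poly_Mapping.lookup p w))"

text \<open>An element of \<open>\<int>[S\<^sup>*]\<close> is coded by the finite graph of its restriction to its support.\<close>

definition word_ring_encode :: "(nat list \<Rightarrow>\<^sub>0 int) \<Rightarrow> nat" where
  "word_ring_encode p =
     set_encode ((\<lambda>w. prod_encode (list_encode w, int_encode (Poly_Mapping.lookup p w)))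
       ` Poly_Mapping.keys p)"

definition computable_word_ring_seq ::
    "'g list \<Rightarrow> nat \<Rightarrow> (nat \<Rightarrow> (nat list \<Rightarrow>\<^sub>0 int) list) \<Rightarrow> bool" where
  \<comment> \<open>\<open>r\<close> is a total computable map from \<open>\<nat>\<close> to \<open>\<int>[S\<^sup>*]\<^sup>n\<close>\<close>
  "computable_word_ring_seq s n r \<longleftrightarrow>
     (\<forall>k. length (r k) = n \<and> set (r k) \<subseteq> word_ring s) \<and>
     total_computable (\<lambda>k. list_encode (map word_ring_encode (r k)))"

definition presented_set ::
    "('g, 'm) monoid_scheme \<Rightarrow> 'g list \<Rightarrow> nat \<Rightarrow> (nat \<Rightarrow> (nat list \<Rightarrow>\<^sub>0 int) list) \<Rightarrow>
     (nat \<Rightarrow> 'g \<Rightarrow> rmodz) set" where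
  "presented_set G s n r =
     {x \<in> {..<n} \<rightarrow>\<^sub>E (carrier G \<rightarrow>\<^sub>E UNIV).
        \<forall>k. \<forall>h\<in>carrier G. (\<Sum>i<n. star_mult G (x i) (word_ring_value G s (r k ! i)) h) = 0}"

definition presented_group ::
    "('g, 'm) monoid_scheme \<Rightarrow> 'g list \<Rightarrow> nat \<Rightarrow> (nat \<Rightarrow> (nat list \<Rightarrow>\<^sub>0 int) list) \<Rightarrow>
     (nat \<Rightarrow> 'g \<Rightarrow> rmodz) monoid" where
  "presented_group G s n r =
     \<lparr>carrier = presented_set G s n r,
      mult = (\<lambda>x y. \<lambda>i\<in>{..<n}. \<lambda>h\<in>carrier G. x i h + y i h),
      one = (\<lambda>i\<in>{..<n}. \<lambda>h\<in>carrier G. 0)\<rparr>"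

definition presented_topology ::
    "('g, 'm) monoid_scheme \<Rightarrow> 'g list \<Rightarrow> nat \<Rightarrow> (nat \<Rightarrow> (nat list \<Rightarrow>\<^sub>0 int) list) \<Rightarrow>
     (nat \<Rightarrow> 'g \<Rightarrow> rmodz) topology" where
  "presented_topology G s n r =
     subtopology
       (product_topology (\<lambda>_. product_topology (\<lambda>_. euclidean) (carrier G)) {..<n})
       (presented_set G s n r)"

definition presented_action ::
    "('g, 'm) monoid_scheme \<Rightarrow> nat \<Rightarrow> 'g \<Rightarrow> (nat \<Rightarrow> 'g \<Rightarrow> rmodz) \<Rightarrow> (nat \<Rightarrow> 'g \<Rightarrow> rmodz)" where
  "presented_action G n g x = (\<lambda>i\<in>{..<n}. shift G g (x i))"

definition recursively_presented_action ::
    "('g, 'm) monoid_scheme \<Rightarrow> ('x, 'n) monoid_scheme \<Rightarrow> 'x topology \<Rightarrow> ('g \<Rightarrow> 'x \<Rightarrow> 'x) \<Rightarrow> bool" where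
  "recursively_presented_action G X T act \<longleftrightarrow>
     algebraic_action G X T act \<and> finitely_generated_action G X T act \<and>
     (\<exists>s n r. symmetric_generating G s \<and> computable_word_ring_seq s n r \<and>
        algebraic_action_iso G X T act
          (presented_group G s n r) (presented_topology G s n r) (presented_action G n))"

end

theory Submission
  imports Defs
begin

text \<open>
  Choose binary digits for the coordinates of the points of the algebraic action, and record them at
  words over the generators instead of at group elements. A bit sequence arises in this way exactly
  if words with the same value carry the same digits and, for each relation at each word, the integer
  combination of the first \<open>J\<close> digits is for every \<open>J\<close> as close to a multiple of \<open>2\<^sup>J\<close> as the truncation
  error allows. The first condition can be refuted effectively because the group is recursively
  presented, the second because the relations are given by a computable sequence. Hence these
  sequences form an effectively closed set, on which the group acts computably since a generator just
  prepends a letter to the words. Self-simulability makes this action a factor of a subshift of finite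
  type, and summing the binary expansions maps it onto the algebraic action.
\<close>

section \<open>Computable functions between coded types\<close>

text \<open>Equality in the group is only semidecidable, so digits cannot be stored at computable
  normal forms. Indexing by words duplicates every digit, but the agreement of the copies is a
  closed condition of the right kind: an enumeration of equal words eventually exposes any
  disagreement. Carries prevent a digit-by-digit check of a linear relation. Scaling by
  \<open>2 ^ J\<close> and keeping J digits leaves an error in [0, 1] per coordinate, hence at most
  C, the sum of the absolute values of the coefficients. Since C does not depend on J, the tests for
  all J together put the real sum within 2 C / 2 ^ J of an integer for every J, which forces it to
  be an integer, although each test reads only finitely many bits. The action merely moves digits
  between group elements and involves no arithmetic on them.\<close>

lemma computes_Comp1:
  "computes g xs a \<Longrightarrow> computes f [a] z \<Longrightarrow> computes (Comp f [g]) xs z"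
  by (rule computes.comp[of _ _ "[a]"]) simp_all

lemma computes_Comp2:
  "computes g xs a \<Longrightarrow> computes h xs b \<Longrightarrow> computes f [a, b] z \<Longrightarrow> computes (Comp f [g, h]) xs z"
  by (rule computes.comp[of _ _ "[a, b]"]) simp_all

lemma computes_Comp3:
  "computes g xs a \<Longrightarrow> computes h xs b \<Longrightarrow> computes k xs c \<Longrightarrow> computes f [a, b, c] z \<Longrightarrow>
    computes (Comp f [g, h, k]) xs z"
  by (rule computes.comp[of _ _ "[a, b, c]"]) simp_all

lemma computes_Comp1_iff:
  assumes "computes g xs a"
  shows "computes (Comp f [g]) xs z \<longleftrightarrow> computes f [a] z"
proof
  assume "computes (Comp f [g]) xs z"
  then show "computes f [a] z"
    by cases (auto simp: list_all2_Cons1 dest: computes_deterministic[OF assms])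
qed (rule computes_Comp1[OF assms])

lemma computes_Proj0: "computes (Proj 0) (x # xs) x"
  using computes.proj[of 0 "x # xs"] by simp

lemma computes_Proj1: "computes (Proj 1) (x # y # xs) y"
  using computes.proj[of 1 "x # y # xs"] by simp

lemma computes_Proj2: "computes (Proj 2) (x # y # z # xs) z"
  using computes.proj[of 2 "x # y # z # xs"] by simp

lemmas computes_basic =
  computes.zero computes.succ computes_Proj0 computes_Proj1 computes_Proj2
  computes_Comp1 computes_Comp2 computes_Comp3

definition r_const :: "nat \<Rightarrow> recf" where
  "r_const k = ((\<lambda>f. Comp Succ [f]) ^^ k) Zero"

lemma computes_const: "computes (r_const k) xs k"
  unfolding r_const_def by (induction k) (auto intro: computes_basic)

definition r_add :: recf where
  "r_add = Prec (Proj 0) (Comp Succ [Proj 1])"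

lemma computes_add: "computes r_add (m # n # xs) (m + n)"
  unfolding r_add_def
proof (induction m)
  case 0
  show ?case by (simp add: computes.prec_0 computes_basic)
next
  case (Suc m)
  show ?case by (rule computes.prec_Suc[OF Suc]) (unfold add_Suc, (rule computes_basic)+)
qed

definition r_pred :: recf where
  "r_pred = Prec Zero (Proj 0)"

lemma computes_pred: "computes r_pred [n] (n - 1)"
  unfolding r_pred_def
proof (induction n)
  case 0
  show ?case by (simp add: computes.prec_0 computes_basic)
next
  case (Suc n)
  show ?case by (rule computes.prec_Suc[OF Suc]) (unfold diff_Suc_1, rule computes_basic)
qed

text \<open>The subtrahend comes first, since \<open>Prec\<close> recurses on its first argument and
  truncated subtraction is the iterated predecessor.\<close>

definition r_sub :: recf where
  "r_sub = Prec (Proj 0) (Comp r_pred [Proj 1])"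

lemma computes_sub: "computes r_sub [n, m] (m - n)"
  unfolding r_sub_def
proof (induction n)
  case 0
  show ?case by (simp add: computes.prec_0 computes_basic)
next
  case (Suc n)
  have "computes (Comp r_pred [Proj 1]) [n, m - n, m] (m - n - 1)"
    by (rule computes_Comp1[OF computes_Proj1 computes_pred])
  then show ?case using computes.prec_Suc[OF Suc] by simp
qed

definition r_triangle :: recf where
  "r_triangle = Prec Zero (Comp Succ [Comp r_add [Proj 0, Proj 1]])"

lemma computes_triangle: "computes r_triangle [n] (triangle n)"
  unfolding r_triangle_def
proof (induction n)
  case 0
  show ?case by (simp add: computes.prec_0 computes_basic)
next
  case (Suc n)
  have "computes (Comp Succ [Comp r_add [Proj 0, Proj 1]]) [n, triangle n] (Suc (n + triangle n))"
    by (rule computes_basic computes_add)+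
  then show ?case using computes.prec_Suc[OF Suc] by (simp add: add.commute)
qed

definition r_pair :: recf where
  "r_pair = Comp r_add [Comp r_triangle [r_add], Proj 0]"

text \<open>Surplus arguments \<open>xs\<close> are allowed so that \<open>r_pair\<close> can act
  directly on the argument list of a recursion step, which also carries a parameter.\<close>

lemma computes_pair: "computes r_pair (m # n # xs) (prod_encode (m, n))"
  unfolding r_pair_def prod_encode_def split_conv
  by (rule computes_Comp2 computes_Comp1 computes_add computes_triangle computes_Proj0)+

text \<open>The index of the diagonal on which a code of a pair lies.\<close>

definition r_diag :: recf where
  "r_diag = Mu (Comp r_sub [Comp r_triangle [Comp Succ [Proj 0]], Comp Succ [Proj 1]])"

lemma triangle_mono: "m \<le> n \<Longrightarrow> triangle m \<le> triangle n"
  by (induction n) (auto simp: le_Suc_eq)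

text \<open>The codes on diagonal d fill the interval from \<open>triangle d\<close> up to, but
  excluding, \<open>triangle (Suc d)\<close>. Hence d is the least k for which the truncated
  difference \<open>Suc c - triangle (Suc k)\<close> vanishes at such a code c.\<close>

lemma computes_diag: "computes r_diag [prod_encode (m, n)] (m + n)"
  unfolding r_diag_def
proof (rule computes.mu)
  let ?f = "Comp r_sub [Comp r_triangle [Comp Succ [Proj 0]], Comp Succ [Proj 1]]"
  have f: "computes ?f [k, c] (Suc c - triangle (Suc k))" for k c
    by (rule computes_basic computes_sub computes_triangle)+
  show "computes ?f [m + n, prod_encode (m, n)] 0"
    using f[of "m + n" "prod_encode (m, n)"] by (simp add: prod_encode_def)
  fix k assume "k < m + n"
  then have "triangle (Suc k) \<le> prod_encode (m, n)"
    using triangle_mono[of "Suc k" "m + n"] by (simp add: prod_encode_def del: triangle_Suc)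
  then have "Suc (prod_encode (m, n)) - triangle (Suc k) =
      Suc (prod_encode (m, n) - triangle (Suc k))"
    by (simp del: triangle_Suc add: Suc_diff_le)
  then show "\<exists>y. computes ?f [k, prod_encode (m, n)] (Suc y)"
    using f[of k "prod_encode (m, n)"] by metis
qed

definition r_fst :: recf where
  "r_fst = Comp r_sub [Comp r_triangle [r_diag], Proj 0]"

lemma computes_fst: "computes r_fst [prod_encode (m, n)] m"
proof -
  have "computes r_fst [prod_encode (m, n)] (prod_encode (m, n) - triangle (m + n))"
    unfolding r_fst_def
    by (rule computes_Comp2 computes_Comp1 computes_diag computes_triangle computes_Proj0
        computes_sub)+
  then show ?thesis by (simp add: prod_encode_def)
qed

definition r_snd :: recf where
  "r_snd = Comp r_sub [r_fst, r_diag]"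

lemma computes_snd: "computes r_snd [prod_encode (m, n)] n"
proof -
  have "computes r_snd [prod_encode (m, n)] (m + n - m)"
    unfolding r_snd_def by (rule computes_Comp2 computes_fst computes_diag computes_sub)+
  then show ?thesis by simp
qed

definition r_cond :: recf where
  "r_cond = Prec (Proj 1) (Proj 2)"

lemma computes_cond: "computes r_cond [of_bool b, x, y] (if b then x else y)"
proof -
  have 0: "computes r_cond [0, x, y] y"
    unfolding r_cond_def by (rule computes.prec_0) (rule computes_Proj1)
  moreover have "computes r_cond [Suc 0, x, y] x"
    unfolding r_cond_def
    by (rule computes.prec_Suc[OF 0[unfolded r_cond_def]]) (rule computes_Proj2)
  ultimately show ?thesis by simp
qed

class coded =
  fixes code :: "'a \<Rightarrow> nat"
  assumes inj_code: "inj code"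

instantiation nat :: coded
begin
definition code_nat :: "nat \<Rightarrow> nat" where [simp]: "code_nat n = n"
instance by standard (simp add: inj_def)

end

instantiation bool :: coded
begin
definition code_bool :: "bool \<Rightarrow> nat" where [simp]: "code_bool b = of_bool b"
instance by standard (simp add: inj_def)

end

instantiation prod :: (coded, coded) coded
begin
definition code_prod :: "'a \<times> 'b \<Rightarrow> nat" where
  "code_prod p = prod_encode (code (fst p), code (snd p))"
instance
  by standard (auto simp: inj_def code_prod_def dest: injD[OF inj_code])

end

instantiation list :: (coded) coded
begin
definition code_list :: "'a list \<Rightarrow> nat" where
  "code_list xs = list_encode (map code xs)"
instance
  by standard (auto simp: inj_def code_list_def inj_map_eq_map[OF inj_code] dest: injD[OF inj_list_encode])

end

lemma code_eq_iff [simp]: "code x = code y \<longleftrightarrow> x = y"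
  using inj_code by (auto dest: injD)

lemma code_nat_list [simp]: "code (xs :: nat list) = list_encode xs"
proof -
  have "map code xs = xs" by (induction xs) auto
  then show ?thesis by (simp add: code_list_def)
qed

lemma code_bool_list [simp]: "code (w :: bool list) = bits_encode w"
proof -
  have "code = (of_bool :: bool \<Rightarrow> nat)" by (rule ext) simp
  then show ?thesis by (simp add: code_list_def bits_encode_def)
qed

lemma surj_code_nat [simp]: "surj (code :: nat \<Rightarrow> nat)"
  by (rule surjI[of _ "\<lambda>x. x"]) simp

lemma surj_code_nat_list [simp]: "surj (code :: nat list \<Rightarrow> nat)"
  by (rule surjI[of _ list_decode]) simp

text \<open>Values off the range of \<open>code\<close> are arbitrary. Truth values use only the
  codes 0 and 1, so surjectivity of \<open>code\<close> has to be assumed wherever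
  \<open>decode\<close> itself is to be computed.\<close>

definition decode :: "nat \<Rightarrow> 'a::coded" where
  "decode = inv_into UNIV code"

lemma decode_code [simp]: "decode (code x) = x"
  by (simp add: decode_def inj_code)

lemma code_decode [simp]:
  "surj (code :: 'a::coded \<Rightarrow> nat) \<Longrightarrow> code (decode k :: 'a) = k"
  by (simp add: decode_def surj_f_inv_f)

lemma surj_code_prod [simp]:
  assumes "surj (code :: 'a::coded \<Rightarrow> nat)" "surj (code :: 'b::coded \<Rightarrow> nat)"
  shows "surj (code :: 'a \<times> 'b \<Rightarrow> nat)"
proof (rule surjI)
  fix k :: nat
  show "code (decode (fst (prod_decode k)) :: 'a, decode (snd (prod_decode k)) :: 'b) = k"
    using assms by (simp add: code_prod_def)
qed

section \<open>Closure properties of computable functions\<close>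

definition computable :: "('a::coded \<Rightarrow> 'b::coded) \<Rightarrow> bool" where
  "computable f \<longleftrightarrow> (\<exists>c. \<forall>x. computes c [code x] (code (f x)))"

lemma computableI: "(\<And>x. computes c [code x] (code (f x))) \<Longrightarrow> computable f"
  unfolding computable_def by blast

lemma total_computable_iff: "total_computable g \<longleftrightarrow> computable g"
  unfolding total_computable_def computable_def by simp

named_theorems computable_intros

lemma computable_id [computable_intros]: "computable (\<lambda>x. x)"
  by (rule computableI[of "Proj 0"]) (rule computes_Proj0)

lemma computable_const [computable_intros]: "computable (\<lambda>x. c)"
  by (rule computableI[of "r_const (code c)"]) (rule computes_const)

lemma computable_compose:
  assumes "computable f" "computable g"
  shows "computable (\<lambda>x. f (g x))"
proof -
  from assms obtain c d where "\<And>x. computes c [code x] (code (f x))"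
      "\<And>x. computes d [code x] (code (g x))"
    unfolding computable_def by blast
  then show ?thesis by (intro computableI[of "Comp c [d]"] computes_Comp1)
qed

lemma computable_Pair [computable_intros]:
  assumes "computable f" "computable g"
  shows "computable (\<lambda>x. (f x, g x))"
proof -
  from assms obtain c d where "\<And>x. computes c [code x] (code (f x))"
      "\<And>x. computes d [code x] (code (g x))"
    unfolding computable_def by blast
  then have "computes (Comp r_pair [c, d]) [code x] (code (f x, g x))" for x
    unfolding code_prod_def fst_conv snd_conv
    by - (rule computes_Comp2 computes_pair | blast)+
  then show ?thesis by (rule computableI)
qed

text \<open>Functions of several arguments are recorded as computable in uncurried form; this rule
  and the next apply such a fact to separately computed arguments.\<close>

lemma computable_compose2:
  assumes "computable (\<lambda>p. f (fst p) (snd p))" "computable g" "computable h"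
  shows "computable (\<lambda>x. f (g x) (h x))"
  using computable_compose[OF assms(1) computable_Pair[OF assms(2,3)]] by simp

lemma computable_compose3:
  assumes "computable (\<lambda>p. f (fst p) (fst (snd p)) (snd (snd p)))"
    and "computable g" "computable h" "computable k"
  shows "computable (\<lambda>x. f (g x) (h x) (k x))"
  using computable_compose[OF assms(1) computable_Pair[OF assms(2) computable_Pair[OF assms(3,4)]]]
  by simp

text \<open>A number is its own code, so passing to a code or back leaves the program unchanged. The
  next three rules hold for the same reason.\<close>

lemma computable_code [computable_intros]:
  "computable f \<Longrightarrow> computable (\<lambda>x. code (f x))"
  unfolding computable_def by simp

lemma computable_decode [computable_intros]:
  fixes f :: "'a::coded \<Rightarrow> nat"
  assumes "surj (code :: 'b::coded \<Rightarrow> nat)" "computable f"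
  shows "computable (\<lambda>x. decode (f x) :: 'b)"
  using assms unfolding computable_def by simp

lemma computable_list_decode [computable_intros]:
  "computable f \<Longrightarrow> computable (\<lambda>x. list_decode (f x))"
  unfolding computable_def by simp

lemma computable_prod_decode [computable_intros]:
  "computable f \<Longrightarrow> computable (\<lambda>x. prod_decode (f x))"
  unfolding computable_def by (simp add: code_prod_def)

lemma computable_fst [computable_intros]: "computable f \<Longrightarrow> computable (\<lambda>x. fst (f x))"
  by (rule computable_compose[of fst])
    (auto intro!: computableI[of r_fst] computes_fst simp: code_prod_def)

lemma computable_snd [computable_intros]: "computable f \<Longrightarrow> computable (\<lambda>x. snd (f x))"
  by (rule computable_compose[of snd])
    (auto intro!: computableI[of r_snd] computes_snd simp: code_prod_def)

lemma computable_Suc [computable_intros]: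
  "computable f \<Longrightarrow> computable (\<lambda>x. Suc (f x))"
  by (rule computable_compose[of Suc]) (auto intro!: computableI[of Succ] computes.succ)

text \<open>Both branches are evaluated before \<open>r_cond\<close> selects one, which is harmless
  because \<open>computable\<close> concerns total functions.\<close>

lemma computable_if [computable_intros]:
  assumes "computable P" "computable f" "computable g"
  shows "computable (\<lambda>x. if P x then f x else g x)"
proof -
  from assms obtain b c d where "\<And>x. computes b [code x] (code (P x))"
      "\<And>x. computes c [code x] (code (f x))" "\<And>x. computes d [code x] (code (g x))"
    unfolding computable_def by blast
  then have "computes (Comp r_cond [b, c, d]) [code x] (if P x then code (f x) else code (g x))" for x
    by (intro computes_Comp3[OF _ _ _ computes_cond]) auto
  then have "computes (Comp r_cond [b, c, d]) [code x] (code (if P x then f x else g x))" for x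
    by (metis (full_types))
  then show ?thesis by (rule computableI)
qed

text \<open>The arithmetic, bounded sums and list iterations below reduce to this rule after being
  rewritten as \<open>rec_nat\<close>. The step program repackages its three arguments as the code
  of \<open>(x, n, r)\<close>.\<close>

lemma computable_rec_nat [computable_intros]:
  fixes f :: "'a::coded \<Rightarrow> 'b::coded"
  assumes "computable h" "computable f"
    and "computable (\<lambda>p. g (fst p) (fst (snd p)) (snd (snd p)))"
  shows "computable (\<lambda>x. rec_nat (f x) (g x) (h x))"
proof -
  from assms obtain b c d where b: "\<And>x. computes b [code x] (h x)"
      and c: "\<And>x. computes c [code x] (code (f x))"
      and d: "\<And>p. computes d [code p] (code (g (fst p) (fst (snd p)) (snd (snd p))))"
    unfolding computable_def code_nat_def by blast
  let ?step = "Comp d [Comp r_pair [Proj 2, r_pair]]"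
  have step: "computes ?step [n, code r, code x] (code (g x n r))" for n r x
  proof (rule computes_Comp1)
    show "computes (Comp r_pair [Proj 2, r_pair]) [n, code r, code x] (code (x, n, r))"
      unfolding code_prod_def fst_conv snd_conv code_nat_def
      by (rule computes_Comp2 computes_pair computes_Proj2)+
    show "computes d [code (x, n, r)] (code (g x n r))"
      using d[of "(x, n, r)"] by simp
  qed
  have "computes (Prec c ?step) [n, code x] (code (rec_nat (f x) (g x) n))" for n x
  proof (induction n)
    case 0
    show ?case by (simp add: computes.prec_0 c)
  next
    case (Suc n)
    then show ?case using computes.prec_Suc step by simp
  qed
  then have "computes (Comp (Prec c ?step) [b, Proj 0]) [code x] (code (rec_nat (f x) (g x) (h x)))"
    for x by (rule computes_Comp2[OF b computes_Proj0])
  then show ?thesis by (rule computableI)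
qed

lemma computable_add [computable_intros]:
  fixes f g :: "'a::coded \<Rightarrow> nat"
  assumes "computable f" "computable g"
  shows "computable (\<lambda>x. f x + g x)"
proof -
  have "rec_nat a (\<lambda>_. Suc) b = a + b" for a b by (induction b) auto
  then have "(\<lambda>x. f x + g x) = (\<lambda>x. rec_nat (f x) (\<lambda>_. Suc) (g x))" by simp
  then show ?thesis by (simp only:) (intro computable_intros assms)
qed


lemma computable_mult [computable_intros]:
  fixes f g :: "'a::coded \<Rightarrow> nat"
  assumes "computable f" "computable g"
  shows "computable (\<lambda>x. f x * g x)"
proof -
  have "rec_nat 0 (\<lambda>_ r. r + a) b = a * b" for a b :: nat by (induction b) auto
  then have "(\<lambda>x. f x * g x) = (\<lambda>x. rec_nat 0 (\<lambda>_ r. r + f x) (g x))" by simp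
  then show ?thesis by (simp only:) (intro computable_intros assms[THEN computable_compose])
qed

lemma computable_diff [computable_intros]:
  fixes f g :: "'a::coded \<Rightarrow> nat"
  assumes "computable f" "computable g"
  shows "computable (\<lambda>x. f x - g x)"
proof -
  have pred: "rec_nat 0 (\<lambda>n _. n) b = b - 1" for b :: nat by (cases b) auto
  have "rec_nat a (\<lambda>_ r. rec_nat 0 (\<lambda>n _. n) r) b = a - b" for a b :: nat
    unfolding pred by (induction b) auto
  then have "(\<lambda>x. f x - g x) = (\<lambda>x. rec_nat (f x) (\<lambda>_ r. rec_nat 0 (\<lambda>n _. n) r) (g x))"
    by simp
  then show ?thesis by (simp only:) (intro computable_intros assms[THEN computable_compose])
qed

lemma computable_power [computable_intros]:
  fixes f g :: "'a::coded \<Rightarrow> nat"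
  assumes "computable f" "computable g"
  shows "computable (\<lambda>x. f x ^ g x)"
proof -
  have "rec_nat 1 (\<lambda>_ r. a * r) b = a ^ b" for a b :: nat by (induction b) auto
  then have "(\<lambda>x. f x ^ g x) = (\<lambda>x. rec_nat 1 (\<lambda>_ r. f x * r) (g x))" by simp
  then show ?thesis by (simp only:) (intro computable_intros assms[THEN computable_compose])
qed

lemma computable_not [computable_intros]:
  assumes "computable P"
  shows "computable (\<lambda>x. \<not> P x)"
proof -
  have "computable (\<lambda>x. if P x then False else True)" by (intro computable_intros assms[THEN computable_compose])
  moreover have "(if p then False else True) = (\<not> p)" for p by simp
  ultimately show ?thesis by simp
qed

lemma computable_conj [computable_intros]:
  assumes "computable P" "computable Q"
  shows "computable (\<lambda>x. P x \<and> Q x)"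
proof -
  have "computable (\<lambda>x. if P x then Q x else False)" by (intro computable_intros assms[THEN computable_compose])
  moreover have "(if p then q else False) = (p \<and> q)" for p q by simp
  ultimately show ?thesis by simp
qed

lemma computable_disj [computable_intros]:
  assumes "computable P" "computable Q"
  shows "computable (\<lambda>x. P x \<or> Q x)"
proof -
  have "computable (\<lambda>x. if P x then True else Q x)" by (intro computable_intros assms[THEN computable_compose])
  moreover have "(if p then True else q) = (p \<or> q)" for p q by simp
  ultimately show ?thesis by simp
qed

lemma computable_le [computable_intros]:
  fixes f g :: "'a::coded \<Rightarrow> nat"
  assumes "computable f" "computable g"
  shows "computable (\<lambda>x. f x \<le> g x)"
proof -
  have "rec_nat True (\<lambda>_ _. False) a \<longleftrightarrow> a = 0" for a :: nat by (cases a) auto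
  then have "(\<lambda>x. f x \<le> g x) = (\<lambda>x. rec_nat True (\<lambda>_ _. False) (f x - g x))" by simp
  then show ?thesis by (simp only:) (intro computable_intros assms[THEN computable_compose])
qed

lemma computable_less [computable_intros]:
  fixes f g :: "'a::coded \<Rightarrow> nat"
  assumes "computable f" "computable g"
  shows "computable (\<lambda>x. f x < g x)"
  unfolding less_eq_Suc_le by (intro computable_intros assms[THEN computable_compose])

lemma computable_eq [computable_intros]:
  assumes "computable f" "computable g"
  shows "computable (\<lambda>x. f x = g x)"
proof -
  have "computable (\<lambda>x. code (f x) \<le> code (g x) \<and> code (g x) \<le> code (f x))"
    by (intro computable_intros assms[THEN computable_compose])
  moreover have "code (f x) \<le> code (g x) \<and> code (g x) \<le> code (f x) \<longleftrightarrow> f x = g x" for x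
    unfolding order_eq_iff[symmetric] by simp
  ultimately show ?thesis by simp
qed

lemma computable_mod [computable_intros]:
  fixes f g :: "'a::coded \<Rightarrow> nat"
  assumes "computable f" "computable g"
  shows "computable (\<lambda>x. f x mod g x)"
proof -
  have "rec_nat 0 (\<lambda>_ r. if Suc r = b then 0 else Suc r) a = a mod b" for a b :: nat
    by (induction a) (auto simp: mod_Suc)
  then have "(\<lambda>x. f x mod g x) = (\<lambda>x. rec_nat 0 (\<lambda>_ r. if Suc r = g x then 0 else Suc r) (f x))"
    by simp
  then show ?thesis by (simp only:) (intro computable_intros assms[THEN computable_compose])
qed

lemma computable_div [computable_intros]:
  fixes f g :: "'a::coded \<Rightarrow> nat"
  assumes "computable f" "computable g"
  shows "computable (\<lambda>x. f x div g x)"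
proof -
  have "rec_nat 0 (\<lambda>n r. if Suc n mod b = 0 then Suc r else r) a = a div b" for a b :: nat
    by (induction a) (auto simp: div_Suc)
  then have "(\<lambda>x. f x div g x) =
      (\<lambda>x. rec_nat 0 (\<lambda>n r. if Suc n mod g x = 0 then Suc r else r) (f x))"
    by simp
  then show ?thesis by (simp only:) (intro computable_intros assms[THEN computable_compose])
qed

lemma computable_even [computable_intros]:
  fixes f :: "'a::coded \<Rightarrow> nat"
  assumes "computable f"
  shows "computable (\<lambda>x. even (f x))"
  unfolding even_iff_mod_2_eq_zero by (intro computable_intros assms[THEN computable_compose])

lemma computable_of_bool [computable_intros]:
  assumes "computable P"
  shows "computable (\<lambda>x. of_bool (P x) :: nat)"
  unfolding of_bool_def by (intro computable_intros assms[THEN computable_compose])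

lemma computable_sum [computable_intros]:
  fixes f :: "'a::coded \<Rightarrow> nat \<Rightarrow> nat"
  assumes "computable N" "computable (\<lambda>p. f (fst p) (snd p))"
  shows "computable (\<lambda>x. \<Sum>i<N x. f x i)"
proof -
  have "computable (\<lambda>x. rec_nat 0 (\<lambda>n r. r + f x n) (N x))"
    by (intro computable_intros assms(1)[THEN computable_compose] assms(2)[THEN computable_compose2])
  moreover have "rec_nat 0 (\<lambda>n r. r + f x n) N = (\<Sum>i<N. f x i)" for x N
    by (induction N) auto
  ultimately show ?thesis by simp
qed

text \<open>The members of the set coded by a number are bit positions and hence smaller than the
  number, so a bounded sum with a parity test suffices.\<close>

lemma computable_sum_set_decode [computable_intros]:
  fixes f :: "'a::coded \<Rightarrow> nat \<Rightarrow> nat"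
  assumes "computable N" "computable (\<lambda>p. f (fst p) (snd p))"
  shows "computable (\<lambda>x. \<Sum>i\<in>set_decode (N x). f x i)"
proof -
  have "i < N" if "odd (N div 2 ^ i)" for i N :: nat
  proof -
    have "2 ^ i \<le> N"
      using that by (cases "N < 2 ^ i") auto
    then show ?thesis using less_exp[of i] by (rule less_le_trans[rotated])
  qed
  then have decode: "set_decode N = {i \<in> {..<N}. \<not> even (N div 2 ^ i)}" for N
    unfolding set_decode_def by blast
  have "(\<Sum>i\<in>set_decode (N x). f x i) = (\<Sum>i<N x. if \<not> even (N x div 2 ^ i) then f x i else 0)" for x
    unfolding decode by (rule sum.inter_filter) simp
  then show ?thesis
    by (simp only:) (intro computable_intros assms(1)[THEN computable_compose] assms(2)[THEN computable_compose2])
qed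

lemma computable_tl [computable_intros]:
  assumes "computable f"
  shows "computable (\<lambda>x. tl (f x))"
proof -
  \<comment> \<open>For \<open>[]\<close>, truncated subtraction leaves 0, and 0 codes the pair (0,
    0), so the result is again the code of \<open>[]\<close>.\<close>
  have "code (tl xs) = snd (prod_decode (code xs - 1))" for xs :: "'b list"
    using prod_encode_inverse[of "(0, 0)", unfolded prod_encode_def]
    by (cases xs) (simp_all add: code_list_def)
  moreover have "computable (\<lambda>x. snd (prod_decode (code (f x) - 1)))"
    by (intro computable_intros assms[THEN computable_compose])
  ultimately show ?thesis unfolding computable_def by simp
qed

lemma computable_Cons [computable_intros]:
  assumes "computable f" "computable g"
  shows "computable (\<lambda>x. f x # g x)"
proof -
  have "computable (\<lambda>x. Suc (code (f x, g x)))"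
    by (intro computable_intros assms[THEN computable_compose])
  then show ?thesis unfolding computable_def by (simp add: code_list_def code_prod_def)
qed

lemma computable_Nil_iff [computable_intros]:
  assumes "computable f"
  shows "computable (\<lambda>x. f x = [])"
proof -
  have "computable (\<lambda>x. code (f x) = 0)" by (intro computable_intros assms[THEN computable_compose])
  moreover have "code xs = 0 \<longleftrightarrow> xs = []" for xs :: "'b list"
    by (cases xs) (auto simp: code_list_def)
  ultimately show ?thesis by simp
qed

lemma computable_hd [computable_intros]:
  fixes f :: "'a::coded \<Rightarrow> 'b::coded list"
  assumes "computable f"
  shows "computable (\<lambda>x. hd (f x))"
proof -
  \<comment> \<open>\<open>hd []\<close> is unspecified but fixed, so its code may be built into the
    program as a constant.\<close>
  define c where "c = code (hd [] :: 'b)"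
  have "code (hd xs) = (if xs = [] then c else fst (prod_decode (code xs - 1)))" for xs :: "'b list"
    unfolding c_def by (cases xs) (simp_all add: code_list_def)
  moreover have "computable (\<lambda>x. if f x = [] then c else fst (prod_decode (code (f x) - 1)))"
    by (intro computable_intros assms[THEN computable_compose])
  ultimately have "computable (\<lambda>x. code (hd (f x)))" by simp
  then show ?thesis unfolding computable_def by simp
qed

lemma length_le_code: "length xs \<le> code xs"
proof (induction xs)
  case (Cons x xs)
  have "code xs \<le> prod_encode (code x, code xs)" by (rule le_prod_encode_2)
  then show ?case using Cons by (simp add: code_list_def)
qed simp

text \<open>
  Excess steps of the iteration are idle, so the code of the list serves as a bound on their number.
\<close>

lemma computable_foldl [computable_intros]:
  fixes a :: "'a::coded \<Rightarrow> 'b::coded" and xs :: "'a \<Rightarrow> 'c::coded list"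
  assumes "computable (\<lambda>p. f (fst p) (fst (snd p)) (snd (snd p)))" "computable a" "computable xs"
  shows "computable (\<lambda>x. foldl (f x) (a x) (xs x))"
proof -
  define step where "step x p = (if snd p = [] then p else (f x (fst p) (hd (snd p)), tl (snd p)))"
    for x and p :: "'b \<times> 'c list"
  have step: "rec_nat (b, ys) (\<lambda>_. step x) N = (foldl (f x) b (take N ys), drop N ys)" for x b ys N
  proof (induction N)
    case (Suc N)
    then show ?case
      by (cases "N < length ys")
        (auto simp: step_def take_Suc_conv_app_nth hd_drop_conv_nth drop_Suc tl_drop)
  qed simp
  have "fst (rec_nat (a x, xs x) (\<lambda>_. step x) (code (xs x))) = foldl (f x) (a x) (xs x)" for x
    using length_le_code[of "xs x"] by (simp add: step)
  moreover have "computable (\<lambda>x. fst (rec_nat (a x, xs x) (\<lambda>_. step x) (code (xs x))))"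
    unfolding step_def
    by (intro computable_intros assms(1)[THEN computable_compose3] assms(2,3)[THEN computable_compose])
  ultimately show ?thesis by simp
qed

lemma computable_rev [computable_intros]:
  assumes "computable xs"
  shows "computable (\<lambda>x. rev (xs x))"
proof -
  have "computable (\<lambda>x. foldl (\<lambda>ys y. y # ys) [] (xs x))"
    by (intro computable_intros assms[THEN computable_compose])
  moreover have "foldl (\<lambda>ys y. y # ys) v u = rev u @ v" for u v :: "'b list"
    by (induction u arbitrary: v) auto
  ultimately show ?thesis by simp
qed

lemma computable_append [computable_intros]:
  assumes "computable xs" "computable ys"
  shows "computable (\<lambda>x. xs x @ ys x)"
proof -
  have "computable (\<lambda>x. foldl (\<lambda>zs z. z # zs) (ys x) (rev (xs x)))"
    by (intro computable_intros assms[THEN computable_compose])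
  moreover have "foldl (\<lambda>zs z. z # zs) v (rev u) = u @ v" for u v :: "'b list"
    by (induction u) auto
  ultimately show ?thesis by simp
qed

lemma computable_map [computable_intros]:
  assumes "computable (\<lambda>p. f (fst p) (snd p))" "computable xs"
  shows "computable (\<lambda>x. map (f x) (xs x))"
proof -
  have "computable (\<lambda>x. foldl (\<lambda>zs z. f x z # zs) [] (rev (xs x)))"
    by (intro computable_intros assms(1)[THEN computable_compose2] assms(2)[THEN computable_compose])
  moreover have "foldl (\<lambda>zs z. f x z # zs) [] (rev u) = map (f x) u" for x u
    by (induction u) auto
  ultimately show ?thesis by simp
qed

lemma computable_concat [computable_intros]:
  assumes "computable xs"
  shows "computable (\<lambda>x. concat (xs x))"
proof -
  have "computable (\<lambda>x. foldl (\<lambda>ys y. ys @ y) [] (xs x))" by (intro computable_intros assms[THEN computable_compose])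
  moreover have "foldl (\<lambda>ys y. ys @ y) v u = v @ concat u" for v and u :: "'b list list"
    by (induction u arbitrary: v) auto
  ultimately show ?thesis by simp
qed

lemma computable_length [computable_intros]:
  assumes "computable xs"
  shows "computable (\<lambda>x. length (xs x))"
proof -
  have "computable (\<lambda>x. foldl (\<lambda>n _. Suc n) 0 (xs x))" by (intro computable_intros assms[THEN computable_compose])
  moreover have "foldl (\<lambda>n _. Suc n) k u = k + length u" for k and u :: "'b list"
    by (induction u arbitrary: k) auto
  ultimately show ?thesis by simp
qed

lemma computable_All_less [computable_intros]:
  fixes N :: "'a::coded \<Rightarrow> nat"
  assumes "computable N" "computable (\<lambda>p. P (fst p) (snd p))"
  shows "computable (\<lambda>x. \<forall>i<N x. P x i)"
proof -
  have "computable (\<lambda>x. (\<Sum>i<N x. of_bool (\<not> P x i)) = (0 :: nat))"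
    by (intro computable_intros assms(1)[THEN computable_compose] assms(2)[THEN computable_compose2])
  moreover have "(\<Sum>i<N x. of_bool (\<not> P x i)) = (0 :: nat) \<longleftrightarrow> (\<forall>i<N x. P x i)" for x
    by auto
  ultimately show ?thesis by (simp only:)
qed

lemma computable_nth_default [computable_intros]:
  assumes "computable d" "computable xs" "computable i"
  shows "computable (\<lambda>x. nth_default (d x) (xs x) (i x))"
proof -
  have "computable (\<lambda>x. rec_nat (xs x) (\<lambda>_. tl) (i x))" by (intro computable_intros assms[THEN computable_compose])
  moreover have "rec_nat u (\<lambda>_. tl) k = drop k u" for u :: "'b list" and k
    by (induction k) (auto simp: drop_Suc tl_drop)
  ultimately have "computable (\<lambda>x. drop (i x) (xs x))" by simp
  then have "computable (\<lambda>x. if drop (i x) (xs x) = [] then d x else hd (drop (i x) (xs x)))"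
    by (intro computable_intros assms[THEN computable_compose])
  moreover have "(if drop k u = [] then c else hd (drop k u)) = nth_default c u k" for c k and u :: "'b list"
    by (auto simp: nth_default_def hd_drop_conv_nth)
  ultimately show ?thesis by simp
qed

section \<open>Recursively enumerable sets, effectively closed sets and computable maps on Cantor
  space\<close>

lemma re_UNIV: "re UNIV"
  unfolding re_def by (rule exI[of _ Zero]) (auto intro: computes.zero)

text \<open>Only termination matters: \<open>f\<close> halts at \<open>g k\<close> exactly when
  \<open>g k\<close> is in \<open>A\<close>, and the search over \<open>?c\<close>, which ignores
  its search variable, stops exactly when \<open>P k\<close> holds.\<close>

lemma re_restrict_vimage:
  assumes "re A" "computable P" "computable g"
  shows "re {k. P k \<and> g k \<in> A}"
proof -
  obtain f where f: "A = {k. \<exists>y. computes f [k] y}" using assms(1) unfolding re_def by blast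
  have "computable (\<lambda>k. \<not> P k)" by (intro computable_intros assms(2))
  then obtain c where c: "\<And>k. computes c [k] (of_bool (\<not> P k))"
    unfolding computable_def by auto
  obtain d where d: "\<And>k. computes d [k] (g k)"
    using assms(3) unfolding computable_def by auto
  let ?c = "Comp c [Proj 1]"
  have c': "computes ?c [m, k] (of_bool (\<not> P k))" for m k
    by (rule computes_Comp1[OF computes_Proj1 c])
  have "(\<exists>y. computes (Comp (Proj 0) [Comp f [d], Mu ?c]) [k] y) \<longleftrightarrow> P k \<and> g k \<in> A" for k
  proof
    assume "\<exists>y. computes (Comp (Proj 0) [Comp f [d], Mu ?c]) [k] y"
    then obtain y ys where "list_all2 (\<lambda>h y. computes h [k] y) [Comp f [d], Mu ?c] ys"
      by (auto elim: computes.cases)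
    then obtain a b where a: "computes (Comp f [d]) [k] a" and b: "computes (Mu ?c) [k] b"
      by (auto simp: list_all2_Cons1)
    from a have "g k \<in> A" unfolding f computes_Comp1_iff[OF d] by blast
    moreover from b have "computes ?c [b, k] 0" by cases
    then have "P k" using computes_deterministic[OF c'[of b k]] by fastforce
    ultimately show "P k \<and> g k \<in> A" by blast
  next
    assume k: "P k \<and> g k \<in> A"
    then obtain a where a: "computes (Comp f [d]) [k] a"
      unfolding f using computes_Comp1[OF d] by blast
    have "computes (Mu ?c) [k] 0"
      by (rule computes.mu) (use c'[of 0 k] k in auto)
    then show "\<exists>y. computes (Comp (Proj 0) [Comp f [d], Mu ?c]) [k] y"
      using computes_Comp2[OF a _ computes_Proj0] by blast
  qed
  then show ?thesis unfolding re_def by blast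
qed

text \<open>A number that is no code may be decoded to anything; the decidable test
  \<open>code (dec k) = k\<close> discards it.\<close>

lemma re_image_code:
  fixes dec :: "nat \<Rightarrow> 'a::coded"
  assumes "re A" "computable (P :: 'a \<Rightarrow> bool)" "computable g" "computable dec" "\<And>x. dec (code x) = x"
  shows "re (code ` {x. P x \<and> g x \<in> A})"
proof -
  have "re {k. (code (dec k) = k \<and> P (dec k)) \<and> g (dec k) \<in> A}"
    by (intro re_restrict_vimage computable_intros assms(1) assms(2-4)[THEN computable_compose])
  also have "{k. (code (dec k) = k \<and> P (dec k)) \<and> g (dec k) \<in> A} = code ` {x. P x \<and> g x \<in> A}"
    using assms(5) by (force simp: image_iff)
  finally show ?thesis .
qed

definition bits_decode :: "nat \<Rightarrow> bool list" where
  "bits_decode k = map (\<lambda>i. i \<noteq> 0) (list_decode k)"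

lemma bits_decode_encode [simp]: "bits_decode (bits_encode w) = w"
  by (simp add: bits_decode_def bits_encode_def comp_def)

lemma computable_bits_decode [computable_intros]:
  "computable f \<Longrightarrow> computable (\<lambda>x. bits_decode (f x))"
  unfolding bits_decode_def by (intro computable_intros)

text \<open>
  A violated condition can be searched for without dovetailing: the length of a word \<open>u\<close> codes the
  violated condition together with a padding that makes \<open>u\<close> long enough to exhibit the violation.
\<close>

lemma effectively_closed_Collect:
  fixes c :: "'t::coded \<Rightarrow> nat" and R :: "(nat \<Rightarrow> bool) \<Rightarrow> 't \<Rightarrow> bool"
  assumes surj: "surj (code :: 't \<Rightarrow> nat)" and A: "re A"
    and c: "computable c" and Q: "computable Q"
    and R: "computable (\<lambda>p. R (nth_default False (fst p)) (snd p))"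
    and modulus: "\<And>t z z'. (\<And>i. i < Q t \<Longrightarrow> z i = z' i) \<Longrightarrow> R z t = R z' t"
  shows "effectively_closed {z. \<forall>t. c t \<in> A \<longrightarrow> R z t}"
proof -
  define T :: "bool list \<Rightarrow> 't" where "T u = decode (snd (prod_decode (length u)))" for u
  have T: "computable T" unfolding T_def by (intro computable_intros surj)
  \<comment> \<open>Because of the length bound, the default \<open>False\<close> beyond the end of
    \<open>u\<close> never influences \<open>R\<close>.\<close>
  define L where "L = {u. (Q (T u) \<le> length u \<and> \<not> R (nth_default False u) (T u)) \<and> c (T u) \<in> A}"
  have "re (code ` L)"
    unfolding L_def
    by (rule re_image_code[of _ _ _ bits_decode])
      (simp_all, (intro A computable_intros c[THEN computable_compose] Q[THEN computable_compose]
        R[THEN computable_compose2] T)+)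
  moreover have "code ` L = bits_encode ` L" by simp
  moreover have "- {z. \<forall>t. c t \<in> A \<longrightarrow> R z t} = (\<Union>u\<in>L. cylinder u)"
  proof (intro Set.set_eqI iffI)
    fix z assume "z \<in> - {z. \<forall>t. c t \<in> A \<longrightarrow> R z t}"
    then obtain t where t: "c t \<in> A" "\<not> R z t" by blast
    \<comment> \<open>The padding is \<open>Q t\<close> itself, since a pair code is at least as
      large as its first component.\<close>
    define u where "u = map z [0..<prod_encode (Q t, code t)]"
    have Tu: "T u = t" unfolding T_def u_def by simp
    have le: "Q t \<le> length u" unfolding u_def by (simp add: le_prod_encode_1)
    have "R z t = R (nth_default False u) t"
      by (rule modulus) (use le in \<open>simp add: nth_default_def u_def\<close>)
    then have "u \<in> L" using t le by (simp add: L_def Tu)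
    moreover have "z \<in> cylinder u" by (simp add: cylinder_def u_def)
    ultimately show "z \<in> (\<Union>u\<in>L. cylinder u)" by blast
  next
    fix z assume "z \<in> (\<Union>u\<in>L. cylinder u)"
    then obtain u where u: "u \<in> L" "z \<in> cylinder u" by blast
    have "R z (T u) = R (nth_default False u) (T u)"
      by (rule modulus) (use u in \<open>auto simp: nth_default_def cylinder_def L_def\<close>)
    then show "z \<in> - {z. \<forall>t. c t \<in> A \<longrightarrow> R z t}" using u by (auto simp: L_def)
  qed
  ultimately show ?thesis unfolding effectively_closed_def effectively_open_def by metis
qed

text \<open>It is decidable whether a prefix \<open>u\<close> already shows the letters of
  \<open>w\<close> at the positions \<open>q i\<close>, and these prefixes cover the preimage of the
  cylinder of \<open>w\<close> in \<open>X\<close>.\<close>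

lemma computable_map_on_reindex:
  assumes q: "computable q" and f: "\<And>z. z \<in> X \<Longrightarrow> f z = (\<lambda>i. z (q i))"
  shows "computable_map_on X f"
proof -
  define P where "P p \<longleftrightarrow> (\<forall>i<length (fst p).
      q i < length (snd p) \<and> nth_default False (snd p) (q i) = nth_default False (fst p) i)"
    for p :: "bool list \<times> bool list"
  have P: "computable P"
    unfolding P_def by (intro computable_intros q[THEN computable_compose])
  \<comment> \<open>The criterion \<open>P\<close> is decidable, so the r.e. condition of the
    general rule is filled by a trivial one.\<close>
  have "re (code ` {p. P p \<and> (0::nat) \<in> UNIV})"
    by (rule re_image_code[of _ _ _ "\<lambda>k. (bits_decode (fst (prod_decode k)), bits_decode (snd (prod_decode k)))"])
      (auto intro!: re_UNIV P computable_intros simp: code_prod_def)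
  moreover have "code = (\<lambda>(w, u). prod_encode (bits_encode w, bits_encode u))"
    by (auto simp: code_prod_def)
  moreover have "{z \<in> X. f z \<in> cylinder w} = (\<Union>u\<in>{u. (w, u) \<in> {p. P p}}. cylinder u) \<inter> X" for w
  proof (intro Set.set_eqI iffI)
    fix z assume z: "z \<in> {z \<in> X. f z \<in> cylinder w}"
    \<comment> \<open>The sum replaces the maximum of the positions \<open>q i\<close>; any prefix
      that reaches beyond all of them will do.\<close>
    define u where "u = map z [0..<Suc (\<Sum>i<length w. q i)]"
    have "q i \<le> (\<Sum>i<length w. q i)" if "i < length w" for i
      using that by (intro member_le_sum) auto
    then have "P (w, u)"
      using z f[of z] unfolding P_def u_def
      by (auto simp: nth_default_def cylinder_def less_Suc_eq_le simp del: upt_Suc)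
    moreover have "z \<in> cylinder u" by (simp add: cylinder_def u_def del: upt_Suc)
    ultimately show "z \<in> (\<Union>u\<in>{u. (w, u) \<in> {p. P p}}. cylinder u) \<inter> X" using z by auto
  next
    fix z assume "z \<in> (\<Union>u\<in>{u. (w, u) \<in> {p. P p}}. cylinder u) \<inter> X"
    then show "z \<in> {z \<in> X. f z \<in> cylinder w}"
      using f[of z] by (auto simp: P_def cylinder_def nth_default_def)
  qed
  ultimately show ?thesis unfolding computable_map_on_def by (intro exI[of _ "{p. P p}"]) simp
qed

section \<open>Words and the word problem\<close>

text \<open>
  Every natural number is a letter: the ones beyond the given list stand for the neutral element,
  so that all lists of numbers are words.
\<close>

definition wval :: "('g, 'm) monoid_scheme \<Rightarrow> 'g list \<Rightarrow> nat list \<Rightarrow> 'g" where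
  "wval G s w = foldr (\<lambda>i a. nth_default \<one>\<^bsub>G\<^esub> s i \<otimes>\<^bsub>G\<^esub> a) w \<one>\<^bsub>G\<^esub>"

lemma word_value_eq_wval: "w \<in> words s \<Longrightarrow> word_value G s w = wval G s w"
  by (induction w) (auto simp: word_value_def wval_def words_def nth_default_def)

lemma words_append [simp]: "u @ v \<in> words s \<longleftrightarrow> u \<in> words s \<and> v \<in> words s"
  by (auto simp: words_def)

lemma wval_Nil [simp]: "wval G s [] = \<one>\<^bsub>G\<^esub>"
  by (simp add: wval_def)

lemma wval_Cons: "wval G s (i # w) = nth_default \<one>\<^bsub>G\<^esub> s i \<otimes>\<^bsub>G\<^esub> wval G s w"
  by (simp add: wval_def)

context group
begin

lemma nth_default_closed: "set s \<subseteq> carrier G \<Longrightarrow> nth_default \<one> s i \<in> carrier G"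
  by (auto simp: nth_default_def)

lemma wval_closed [simp]: "set s \<subseteq> carrier G \<Longrightarrow> wval G s w \<in> carrier G"
  by (induction w) (auto simp: wval_Cons nth_default_closed)

lemma wval_append:
  "set s \<subseteq> carrier G \<Longrightarrow> wval G s (u @ v) = wval G s u \<otimes> wval G s v"
  by (induction u) (auto simp: wval_Cons m_assoc nth_default_closed)

lemma ex_word:
  assumes "symmetric_generating G s" "g \<in> carrier G"
  shows "\<exists>w\<in>words s. wval G s w = g"
proof -
  have s: "set s \<subseteq> carrier G" "\<And>a. a \<in> set s \<Longrightarrow> inv a \<in> set s"
      "generate G (set s) = carrier G"
    using assms(1) by (auto simp: symmetric_generating_def)
  have letter: "\<exists>w\<in>words s. wval G s w = a" if "a \<in> set s" for a
  proof -
    from that obtain i where "i < length s" "s ! i = a" by (auto simp: in_set_conv_nth)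
    then show ?thesis
      using s(1) that by (intro bexI[of _ "[i]"]) (auto simp: wval_Cons nth_default_def words_def)
  qed
  have "g \<in> generate G (set s)" using assms(2) s(3) by simp
  then show ?thesis
  proof induction
    case one
    then show ?case by (intro bexI[of _ "[]"]) (auto simp: words_def)
  next
    case (incl h)
    then show ?case by (rule letter)
  next
    case (inv h)
    then show ?case by (intro letter s(2))
  next
    case (eng g h)
    then obtain u v where "u \<in> words s" "wval G s u = g" "v \<in> words s" "wval G s v = h" by blast
    then show ?case by (intro bexI[of _ "u @ v"]) (auto simp: wval_append s(1))
  qed
qed

text \<open>A finite table suffices, and substitution by it is therefore computable: from
  \<open>l\<close> on all values are neutral, and the default word \<open>[]\<close> represents the
  neutral element.\<close>

lemma ex_translation:
  assumes "symmetric_generating G s\<^sub>0" "\<And>i. f i \<in> carrier G" "\<And>i. i \<ge> l \<Longrightarrow> f i = \<one>"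
  shows "\<exists>t. \<forall>i. nth_default [] t i \<in> words s\<^sub>0 \<and> wval G s\<^sub>0 (nth_default [] t i) = f i"
proof -
  have "\<forall>i. \<exists>w. w \<in> words s\<^sub>0 \<and> wval G s\<^sub>0 w = f i"
    using ex_word[OF assms(1,2)] by blast
  then obtain W where "\<And>i. W i \<in> words s\<^sub>0 \<and> wval G s\<^sub>0 (W i) = f i" by metis
  then show ?thesis
    by (intro exI[of _ "map W [0..<l]"]) (auto simp: nth_default_def words_def assms(3))
qed

text \<open>The group may be presented over other generators than \<open>s\<close>. Two words over
  \<open>s\<close> agree exactly when the first times the inverse of the second is trivial, and this
  product is written over \<open>s\<^sub>0\<close> by substitution. As \<open>s\<close> need not be
  closed under inverses here, a second table \<open>t'\<close> translates inverse letters.\<close>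

lemma computable_word_problem:
  assumes "recursively_presented_group G" and s: "set s \<subseteq> carrier G"
  shows "\<exists>A c. re A \<and> computable c \<and> (\<forall>w w'. c (w, w') \<in> A \<longleftrightarrow> wval G s w = wval G s w')"
proof -
  obtain s\<^sub>0 where sym: "symmetric_generating G s\<^sub>0"
    and A: "re (list_encode ` {w \<in> words s\<^sub>0. word_value G s\<^sub>0 w = \<one>})" (is "re ?A")
    using assms(1) unfolding recursively_presented_group_def by blast
  have s0: "set s\<^sub>0 \<subseteq> carrier G" using sym by (simp add: symmetric_generating_def)
  obtain t where t: "\<And>i. nth_default [] t i \<in> words s\<^sub>0"
      "\<And>i. wval G s\<^sub>0 (nth_default [] t i) = nth_default \<one> s i"
    using ex_translation[OF sym, of "nth_default \<one> s" "length s"] s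
    by (auto simp: nth_default_closed nth_default_beyond)
  obtain t' where t': "\<And>i. nth_default [] t' i \<in> words s\<^sub>0"
      "\<And>i. wval G s\<^sub>0 (nth_default [] t' i) = inv (nth_default \<one> s i)"
    using ex_translation[OF sym, of "\<lambda>i. inv (nth_default \<one> s i)" "length s"] s
    by (auto simp: nth_default_closed nth_default_beyond)
  define sub :: "nat list list \<Rightarrow> nat list \<Rightarrow> nat list"
    where "sub t w = concat (map (nth_default [] t) w)" for t w
  have sub: "sub t w \<in> words s\<^sub>0" "wval G s\<^sub>0 (sub t w) = wval G s w" for w
    using t by (induction w) (auto simp: sub_def wval_append[OF s0] wval_Cons words_def)
  have sub': "sub t' w \<in> words s\<^sub>0" for w
    using t' by (induction w) (auto simp: sub_def words_def)
  have inv: "wval G s\<^sub>0 (sub t' (rev w)) = inv (wval G s w)" for w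
    using t' by (induction w)
      (auto simp: sub_def wval_append[OF s0] wval_Cons inv_mult_group nth_default_closed[OF s] s)
  define c where "c p = list_encode (sub t (fst p) @ sub t' (rev (snd p)))" for p
  have "computable (\<lambda>p. code (sub t (fst p) @ sub t' (rev (snd p))))"
    unfolding sub_def by (intro computable_intros)
  then have "computable c" by (simp add: c_def[abs_def])
  moreover have "c (w, w') \<in> ?A \<longleftrightarrow> wval G s w = wval G s w'" for w w'
  proof -
    have u: "sub t w @ sub t' (rev w') \<in> words s\<^sub>0" using sub sub' by simp
    have "c (w, w') \<in> ?A \<longleftrightarrow> word_value G s\<^sub>0 (sub t w @ sub t' (rev w')) = \<one>"
      using u by (auto simp: c_def dest: injD[OF inj_list_encode])
    also have "\<dots> \<longleftrightarrow> wval G s w \<otimes> inv (wval G s w') = \<one>"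
      by (simp add: word_value_eq_wval[OF u] wval_append[OF s0] sub inv)
    also have "\<dots> \<longleftrightarrow> wval G s w = wval G s w'"
      using s by (metis inv_closed inv_equality inv_inv r_inv wval_closed)
    finally show ?thesis .
  qed
  ultimately show ?thesis using A by blast
qed

end

section \<open>Binary expansions\<close>

definition bval :: "(nat \<Rightarrow> bool) \<Rightarrow> real" where
  "bval y = suminf (\<lambda>j. of_bool (y j) * (1 / 2) ^ Suc j)"

definition btrunc :: "(nat \<Rightarrow> bool) \<Rightarrow> nat \<Rightarrow> nat" where
  "btrunc y J = (\<Sum>j<J. of_bool (y j) * 2 ^ (J - Suc j))"

lemma bval_summable: "summable (\<lambda>j. of_bool (y j) * (1 / 2 :: real) ^ Suc j)"
  by (rule summable_comparison_test'[of "\<lambda>j. (1 / 2 :: real) ^ Suc j" 0])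
    (auto intro!: summable_mult summable_geometric)

lemma bval_nonneg: "0 \<le> bval y"
  unfolding bval_def by (rule suminf_nonneg[OF bval_summable]) simp

lemma bval_le_1: "bval y \<le> 1"
proof -
  have "bval y \<le> suminf (\<lambda>j. (1 / 2 :: real) ^ Suc j)"
    unfolding bval_def by (rule suminf_le[OF _ bval_summable]) (auto intro!: summable_mult summable_geometric)
  also have "\<dots> = 1" using power_half_series by (rule sums_unique[symmetric])
  finally show ?thesis .
qed

lemma bval_btrunc: "2 ^ J * bval y = real (btrunc y J) + bval (\<lambda>j. y (j + J))"
proof -
  have "2 ^ J * bval y = suminf (\<lambda>j. 2 ^ J * (of_bool (y j) * (1 / 2) ^ Suc j))"
    unfolding bval_def by (rule suminf_mult[OF bval_summable, symmetric])
  also have "\<dots> = suminf (\<lambda>j. 2 ^ J * (of_bool (y (j + J)) * (1 / 2) ^ Suc (j + J))) +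
      (\<Sum>j<J. 2 ^ J * (of_bool (y j) * (1 / 2) ^ Suc j))"
    by (rule suminf_split_initial_segment) (rule summable_mult[OF bval_summable])
  also have "(\<lambda>j. 2 ^ J * (of_bool (y (j + J)) * (1 / 2 :: real) ^ Suc (j + J))) =
      (\<lambda>j. of_bool (y (j + J)) * (1 / 2) ^ Suc j)"
    by (auto simp: power_add field_simps)
  also have "(\<Sum>j<J. 2 ^ J * (of_bool (y j) * (1 / 2) ^ Suc j)) = real (btrunc y J)"
    unfolding btrunc_def of_nat_sum
  proof (rule sum.cong[OF refl])
    fix j assume "j \<in> {..<J}"
    then have "(2 :: real) ^ J = 2 ^ (J - Suc j) * 2 ^ Suc j"
      by (simp add: power_add[symmetric] del: power_Suc)
    then show "2 ^ J * (of_bool (y j) * (1 / 2) ^ Suc j) = real (of_bool (y j) * 2 ^ (J - Suc j))"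
      by (simp add: power_one_over)
  qed
  finally show ?thesis unfolding bval_def by simp
qed

text \<open>The remainder after \<open>J\<close> digits is again a \<open>bval\<close>, hence in
  [0, 1]. A tail of ones attains 1, so the upper bound cannot be strict.\<close>

lemma bval_bounds:
  "real (btrunc y J) \<le> 2 ^ J * bval y" "2 ^ J * bval y \<le> real (btrunc y J) + 1"
  using bval_btrunc[of J y] bval_nonneg bval_le_1 by (metis add_increasing2 order_refl add_left_mono)+

lemma btrunc_Suc: "btrunc y (Suc J) = 2 * btrunc y J + of_bool (y J)"
proof -
  have "(\<Sum>j<J. of_bool (y j) * 2 ^ (Suc J - Suc j)) = 2 * btrunc y J"
    unfolding btrunc_def sum_distrib_left
    by (rule sum.cong) (auto simp: Suc_diff_Suc mult.commute power_Suc[symmetric] simp del: power_Suc)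
  then show ?thesis by (simp add: btrunc_def)
qed

lemma eq_if_dyadically_close:
  fixes a b :: real
  assumes "\<And>J. \<bar>2 ^ J * a - 2 ^ J * b\<bar> \<le> c"
  shows "a = b"
proof (rule ccontr)
  assume "a \<noteq> b"
  then have "0 < \<bar>a - b\<bar>" by simp
  obtain J where "c / \<bar>a - b\<bar> < 2 ^ J" using real_arch_pow[of 2 "c / \<bar>a - b\<bar>"] by auto
  then have "c < 2 ^ J * \<bar>a - b\<bar>" using \<open>0 < \<bar>a - b\<bar>\<close> by (simp add: field_simps)
  also have "\<dots> = \<bar>2 ^ J * a - 2 ^ J * b\<bar>" by (simp add: abs_mult right_diff_distrib[symmetric])
  finally show False using assms[of J] by simp
qed

lemma ex_binary_expansion:
  assumes "0 \<le> x" "x < 1"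
  shows "\<exists>y. bval y = x"
proof
  \<comment> \<open>With these digits the truncations are the floors of \<open>2 ^ J * x\<close>,
    because halving the next floor and rounding down gives the previous one.\<close>
  define y where "y j \<longleftrightarrow> odd \<lfloor>2 ^ Suc j * x\<rfloor>" for j
  have trunc: "int (btrunc y J) = \<lfloor>2 ^ J * x\<rfloor>" for J
  proof (induction J)
    case 0
    show ?case using assms by (simp add: btrunc_def floor_eq_iff)
  next
    case (Suc J)
    have "\<lfloor>2 ^ Suc J * x\<rfloor> div 2 = \<lfloor>2 ^ J * x\<rfloor>"
      using floor_divide_real_eq_div[of 2 "2 ^ Suc J * x"] by simp
    then have "\<lfloor>2 ^ Suc J * x\<rfloor> = 2 * \<lfloor>2 ^ J * x\<rfloor> + of_bool (y J)"
      using mult_div_mod_eq[of 2 "\<lfloor>2 ^ Suc J * x\<rfloor>"] by (simp only: y_def mod_2_eq_odd)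
    then show ?case using Suc by (simp add: btrunc_Suc)
  qed
  show "bval y = x"
  proof (rule eq_if_dyadically_close)
    fix J
    show "\<bar>2 ^ J * bval y - 2 ^ J * x\<bar> \<le> 1"
      using bval_bounds[where y = y and J = J] trunc[of J] by linarith
  qed
qed

text \<open>For positive \<open>D\<close> this means that some multiple of \<open>D\<close> lies
  within distance \<open>C\<close> of \<open>T\<close>; phrasing it with remainders avoids the
  quantifier and makes it a finite test.\<close>

definition near_multiple :: "int \<Rightarrow> int \<Rightarrow> int \<Rightarrow> bool" where
  "near_multiple D C T \<longleftrightarrow> T mod D \<le> C \<or> D - T mod D \<le> C"

lemma near_multipleI:
  assumes "D > 0" "\<bar>T - D * m\<bar> \<le> C"
  shows "near_multiple D C T"
proof -
  define q r where "q = T div D" and "r = T mod D"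
  have T: "T = D * q + r" by (simp add: q_def r_def)
  have "r \<le> C \<or> D - r \<le> C"
  proof (cases "m \<le> q")
    case True
    then have "D * m \<le> D * q" using assms(1) by simp
    then have "r \<le> C" using assms(2) unfolding T by linarith
    then show ?thesis ..
  next
    case False
    then have "D * (q + 1) \<le> D * m" using assms(1) by (intro mult_left_mono) auto
    then have "D - r \<le> C" using assms(2) unfolding T distrib_left by linarith
    then show ?thesis ..
  qed
  then show ?thesis by (simp add: near_multiple_def r_def)
qed

lemma near_multipleE:
  assumes "D > 0" "near_multiple D C T"
  obtains m where "\<bar>T - D * m\<bar> \<le> C"
proof -
  define q r where "q = T div D" and "r = T mod D"
  have T: "T = D * q + r" by (simp add: q_def r_def)
  have "0 \<le> r" "r < D" using assms(1) by (simp_all add: r_def)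
  moreover have "r \<le> C \<or> D - r \<le> C" using assms(2) by (simp add: near_multiple_def r_def)
  ultimately have "\<bar>T - D * q\<bar> \<le> C \<or> \<bar>T - D * (q + 1)\<bar> \<le> C"
    unfolding T distrib_left by linarith
  then show ?thesis using that by blast
qed

text \<open>Scaled by \<open>2 ^ J\<close>, the real sum differs from the integer combination by at
  most the sum of the \<open>\<bar>c i\<bar>\<close>. If the real sum is an integer, its scaling is
  a multiple of \<open>2 ^ J\<close>. Conversely, nearby multiples for all \<open>J\<close>, divided
  by \<open>2 ^ J\<close>, are integers converging to the real sum, and the integers are
  closed.\<close>

lemma sum_in_Ints_iff_near_multiple:
  fixes c :: "'i \<Rightarrow> int" and b :: "'i \<Rightarrow> real" and N :: "'i \<Rightarrow> nat \<Rightarrow> nat"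
  assumes lower: "\<And>i J. real (N i J) \<le> 2 ^ J * b i"
    and upper: "\<And>i J. 2 ^ J * b i \<le> real (N i J) + 1"
  shows "(\<Sum>i\<in>I. of_int (c i) * b i) \<in> \<int> \<longleftrightarrow>
    (\<forall>J. near_multiple (2 ^ J) (\<Sum>i\<in>I. \<bar>c i\<bar>) (\<Sum>i\<in>I. c i * int (N i J)))"
proof -
  define t where "t = (\<Sum>i\<in>I. of_int (c i) * b i)"
  define C where "C = (\<Sum>i\<in>I. \<bar>c i\<bar>)"
  define S where "S J = (\<Sum>i\<in>I. c i * int (N i J))" for J
  have close: "\<bar>2 ^ J * t - of_int (S J)\<bar> \<le> of_int C" for J
  proof -
    have "2 ^ J * t - of_int (S J) = (\<Sum>i\<in>I. of_int (c i) * (2 ^ J * b i - real (N i J)))"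
      unfolding t_def S_def by (simp add: sum_distrib_left sum_subtractf algebra_simps)
    also have "\<bar>\<dots>\<bar> \<le> (\<Sum>i\<in>I. \<bar>of_int (c i) * (2 ^ J * b i - real (N i J))\<bar>)" by (rule sum_abs)
    also have "\<dots> \<le> (\<Sum>i\<in>I. \<bar>of_int (c i)\<bar>)"
    proof (rule sum_mono)
      fix i
      have "\<bar>2 ^ J * b i - real (N i J)\<bar> \<le> 1" using lower[of i J] upper[of J i] by simp
      then show "\<bar>of_int (c i) * (2 ^ J * b i - real (N i J))\<bar> \<le> \<bar>of_int (c i) :: real\<bar>"
        unfolding abs_mult by (rule mult_left_le) simp
    qed
    finally show ?thesis by (simp add: C_def)
  qed
  have "t \<in> \<int> \<longleftrightarrow> (\<forall>J. near_multiple (2 ^ J) C (S J))"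
  proof
    assume "t \<in> \<int>"
    then obtain m where m: "t = of_int m" by (elim Ints_cases)
    show "\<forall>J. near_multiple (2 ^ J) C (S J)"
    proof
      fix J
      have "\<bar>real_of_int (S J - 2 ^ J * m)\<bar> \<le> of_int C" using close[of J] m by simp
      then have "\<bar>S J - 2 ^ J * m\<bar> \<le> C" by linarith
      then show "near_multiple (2 ^ J) C (S J)" by (intro near_multipleI) simp_all
    qed
  next
    assume near: "\<forall>J. near_multiple (2 ^ J) C (S J)"
    have "\<exists>m. \<bar>S J - 2 ^ J * m\<bar> \<le> C" for J
      using near near_multipleE[of "2 ^ J" C "S J"] by auto
    then obtain m where m: "\<And>J. \<bar>S J - 2 ^ J * m J\<bar> \<le> C" by metis
    \<comment> \<open>One \<open>C\<close> is the truncation error, the other the distance from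
      \<open>S J\<close> to \<open>2 ^ J * m J\<close>; division by \<open>2 ^ J\<close> makes their
      sum tend to 0.\<close>
    have bound: "\<bar>of_int (m J) - t\<bar> \<le> 2 * of_int C * (1 / 2) ^ J" for J
    proof -
      have "real_of_int \<bar>S J - 2 ^ J * m J\<bar> \<le> of_int C"
        using m[of J] by (simp only: of_int_le_iff)
      then have "\<bar>2 ^ J * (of_int (m J) - t)\<bar> \<le> 2 * of_int C"
        using close[of J] by (simp add: right_diff_distrib)
      then have "2 ^ J * \<bar>of_int (m J) - t\<bar> \<le> 2 * of_int C" unfolding abs_mult by simp
      then show ?thesis by (simp add: power_one_over pos_le_divide_eq mult.commute)
    qed
    have "(\<lambda>J. 2 * of_int C * (1 / 2 :: real) ^ J) \<longlonglongrightarrow> 2 * of_int C * 0"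
      by (intro tendsto_mult_left LIMSEQ_power_zero) simp
    then have lim: "(\<lambda>J. 2 * of_int C * (1 / 2 :: real) ^ J) \<longlonglongrightarrow> 0" by simp
    have "(\<lambda>J. of_int (m J) - t) \<longlonglongrightarrow> 0"
      by (rule Lim_null_comparison[OF always_eventually lim]) (simp only: real_norm_def bound simp_thms)
    then have "(\<lambda>J. real_of_int (m J)) \<longlonglongrightarrow> t" by (simp add: LIM_zero_iff)
    from closed_sequentially[OF closed_Ints _ this] show "t \<in> \<int>" by (metis Ints_of_int)
  qed
  then show ?thesis by (simp add: t_def C_def S_def)
qed

section \<open>Binary digits as continuous coordinates on the circle\<close>

lemma abs_rmodz_eq_0_iff: "abs_rmodz t = 0 \<longleftrightarrow> t \<in> \<int>"
  by transfer simp

lemma abs_rmodz_add: "abs_rmodz (s + t) = abs_rmodz s + abs_rmodz t"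
  by (simp add: plus_rmodz.abs_eq)

lemma abs_rmodz_sum: "abs_rmodz (\<Sum>i\<in>I. f i) = (\<Sum>i\<in>I. abs_rmodz (f i))"
  by (induction I rule: infinite_finite_induct) (simp_all add: abs_rmodz_add zero_rmodz_def)

lemma ex_bval_rmodz: "\<exists>y. abs_rmodz (bval y) = x"
proof -
  obtain t where t: "x = abs_rmodz t" by (metis Quotient3_abs_rep Quotient3_rmodz)
  obtain y where "bval y = frac t" using ex_binary_expansion[of "frac t"] by (auto simp: frac_lt_1)
  moreover have "abs_rmodz (frac t) = abs_rmodz t"
    by (simp add: rmodz.abs_eq_iff frac_def)
  ultimately show ?thesis using t by metis
qed

lemma cantor_space_eq_euclidean: "cantor_space = euclidean"
proof -
  have "discrete_topology (UNIV :: bool set) = euclidean"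
    by (simp add: topology_eq open_discrete flip: open_openin)
  then show ?thesis unfolding cantor_space_def by (simp add: euclidean_product_topology)
qed

text \<open>Truncations after \<open>J\<close> digits depend on finitely many bits and are uniformly
  within \<open>(1 / 2) ^ J\<close> of the limit.\<close>

lemma continuous_bval: "continuous_on UNIV (\<lambda>z. bval (\<lambda>j. z (p j :: nat)))"
proof (rule uniform_limit_theorem)
  define f where "f J z = real (btrunc (\<lambda>j. z (p j)) J) / 2 ^ J" for J and z :: "nat \<Rightarrow> bool"
  have "continuous_on UNIV (\<lambda>z. of_bool (z (p j)) :: real)" for j
    by (rule continuous_on_compose2[of UNIV of_bool UNIV "\<lambda>z. z (p j)"])
      (auto intro: continuous_on_product_coordinates continuous_on_discrete)
  then show "\<forall>\<^sub>F J in sequentially. continuous_on UNIV (f J)"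
    unfolding f_def btrunc_def of_nat_sum of_nat_mult of_nat_of_bool
    by (intro always_eventually allI continuous_intros) auto
  show "uniform_limit UNIV f (\<lambda>z. bval (\<lambda>j. z (p j))) sequentially"
  proof (rule uniform_limitI)
    fix e :: real assume "e > 0"
    then have "\<forall>\<^sub>F J in sequentially. (1 / 2) ^ J < e"
      by (intro order_tendstoD(2)[OF LIMSEQ_power_zero]) auto
    then show "\<forall>\<^sub>F J in sequentially. \<forall>z\<in>UNIV. dist (f J z) (bval (\<lambda>j. z (p j))) < e"
    proof (rule eventually_mono, intro ballI)
      fix J z assume e: "(1 / 2) ^ J < e"
      have "\<bar>2 ^ J * (f J z - bval (\<lambda>j. z (p j)))\<bar> \<le> 1"
        using bval_bounds[where J = J and y = "\<lambda>j. z (p j)"]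
        by (simp add: f_def right_diff_distrib)
      then have "2 ^ J * dist (f J z) (bval (\<lambda>j. z (p j))) \<le> 1"
        unfolding abs_mult dist_real_def by simp
      then have "dist (f J z) (bval (\<lambda>j. z (p j))) \<le> (1 / 2) ^ J"
        by (simp add: power_one_over pos_le_divide_eq mult.commute)
      then show "dist (f J z) (bval (\<lambda>j. z (p j))) < e" using e by simp
    qed
  qed
qed simp

lemma continuous_abs_rmodz: "continuous_on UNIV abs_rmodz"
  unfolding continuous_on_open_vimage[OF open_UNIV] by (simp add: open_rmodz_def)

lemma continuous_map_bval_rmodz:
  "continuous_map cantor_space euclidean (\<lambda>z. abs_rmodz (bval (\<lambda>j. z (p j))))"
  unfolding cantor_space_eq_euclidean
  using continuous_on_compose2[OF continuous_abs_rmodz continuous_bval] by auto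

section \<open>The effectively closed cover of an algebraic action\<close>

text \<open>
  These act on \<^const>\<open>int_encode\<close>, where \<open>2 * a\<close> codes \<open>a\<close> and \<open>2 * b + 1\<close> codes \<open>- b - 1\<close>. Replacing the
  factor \<open>-1\<close> by \<open>2\<^sup>J - 1\<close> avoids negative numbers modulo \<open>2\<^sup>J\<close>.
\<close>

definition abs_code :: "nat \<Rightarrow> nat" where
  "abs_code e = (if even e then e div 2 else Suc (e div 2))"

definition residue_code :: "nat \<Rightarrow> nat \<Rightarrow> nat" where
  "residue_code J e = (if even e then e div 2 else Suc (e div 2) * (2 ^ J - 1))"

lemma int_encode_cases:
  obtains a where "c = int a" "int_encode c = 2 * a"
  | b where "c = - int b - 1" "int_encode c = Suc (2 * b)"
proof (cases "0 \<le> c")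
  case True
  then show thesis
    by (intro that(1)[of "nat c"]) (auto simp: int_encode_def sum_encode_def)
next
  case False
  then show thesis
    by (intro that(2)[of "nat (- c - 1)"]) (auto simp: int_encode_def sum_encode_def)
qed

lemma abs_code: "int (abs_code (int_encode c)) = \<bar>c\<bar>"
  by (cases c rule: int_encode_cases) (simp_all add: abs_code_def)

lemma residue_code: "int (residue_code J (int_encode c)) mod 2 ^ J = c mod 2 ^ J"
proof (cases c rule: int_encode_cases)
  case (2 b)
  have "residue_code J (int_encode c) = Suc b * (2 ^ J - 1)"
    using 2(2) by (simp add: residue_code_def)
  then have "int (residue_code J (int_encode c)) = int (Suc b) * int (2 ^ J - 1)"
    by (simp only: of_nat_mult)
  also have "int (2 ^ J - 1) = 2 ^ J - 1" by (simp add: of_nat_diff)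
  also have "int (Suc b) * (2 ^ J - 1) = c + int (Suc b) * 2 ^ J"
    using 2(1) by (simp add: algebra_simps)
  finally show ?thesis by (simp only: mod_mult_self1)
qed (simp add: residue_code_def)

lemma near_multiple_mod_cong:
  "T mod D = T' mod D \<Longrightarrow> near_multiple D C T = near_multiple D C T'"
  by (simp add: near_multiple_def)

text \<open>The remainder is below \<open>2 ^ J\<close>, so truncated subtraction agrees with
  integer subtraction and the test can be run on natural numbers.\<close>

lemma near_multiple_of_nat:
  "near_multiple (2 ^ J) (int C) (int T) \<longleftrightarrow> T mod 2 ^ J \<le> C \<or> 2 ^ J - T mod 2 ^ J \<le> C"
proof -
  define m where "m = T mod 2 ^ J"
  have "int T mod 2 ^ J = int m" by (simp add: m_def zmod_int)
  moreover have "int (2 ^ J - m) = 2 ^ J - int m" by (simp add: m_def of_nat_diff less_imp_le)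
  then have "2 ^ J - int m \<le> int C \<longleftrightarrow> 2 ^ J - m \<le> C" by linarith
  ultimately show ?thesis by (simp only: near_multiple_def m_def[symmetric] of_nat_le_iff)
qed

text \<open>Each support word contributes exactly one member of the coded set, because the word is
  itself part of that member.\<close>

lemma sum_set_decode_word_ring_encode:
  "(\<Sum>b\<in>set_decode (word_ring_encode p). f (fst (prod_decode b)) (snd (prod_decode b))) =
    (\<Sum>w\<in>Poly_Mapping.keys p. f (list_encode w) (int_encode (Poly_Mapping.lookup p w)))"
proof -
  have "inj_on (\<lambda>w. prod_encode (list_encode w, int_encode (Poly_Mapping.lookup p w))) (Poly_Mapping.keys p)"
    by (auto intro!: inj_onI dest!: injD[OF inj_list_encode])
  then show ?thesis unfolding word_ring_encode_def by (simp add: sum.reindex)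
qed

text \<open>The position, in a bit sequence, of binary digit \<open>j\<close> of coordinate
  \<open>i\<close> at the word \<open>w\<close>. Every natural number is such a position.\<close>

definition idx :: "nat list \<Rightarrow> nat \<Rightarrow> nat \<Rightarrow> nat" where
  "idx w i j = code (w, i, j)"

lemma decode_idx [simp]: "decode (idx w i j) = (w, i, j)"
  by (simp add: idx_def)

lemma ex_idx: "\<exists>w i j. p = idx w i j"
proof -
  obtain w i j where "decode p = (w :: nat list, i :: nat, j :: nat)" by (metis prod_cases3)
  moreover have "p = code (decode p :: nat list \<times> nat \<times> nat)"
    by (intro code_decode[symmetric] surj_code_prod surj_code_nat surj_code_nat_list)
  ultimately show ?thesis unfolding idx_def by metis
qed

lemma computable_idx [computable_intros]:
  "computable w \<Longrightarrow> computable i \<Longrightarrow> computable j \<Longrightarrow> computable (\<lambda>x. idx (w x) (i x) (j x))"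
  unfolding idx_def by (intro computable_intros)

locale presentation = group G for G (structure) +
  fixes s :: "'a list" and n :: nat and r :: "nat \<Rightarrow> (nat list \<Rightarrow>\<^sub>0 int) list"
  assumes sym: "symmetric_generating G s" and seq: "computable_word_ring_seq s n r"
begin

lemma s_carrier: "set s \<subseteq> carrier G"
  using sym by (simp add: symmetric_generating_def)

abbreviation val :: "nat list \<Rightarrow> 'a" where
  "val \<equiv> wval G s"

lemmas val_closed [simp] = wval_closed[OF s_carrier]
lemmas val_append = wval_append[OF s_carrier]

text \<open>A non-effective choice of representatives. No program evaluates it: on
  \<open>cover\<close> a bit depends only on the value of the word, so any other representative may
  be substituted.\<close>

definition word :: "'a \<Rightarrow> nat list" where
  "word g = (SOME w. val w = g)"

lemma val_word [simp]: "g \<in> carrier G \<Longrightarrow> val (word g) = g"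
  unfolding word_def using ex_word[OF sym] by (metis (mono_tags) someI_ex)

definition coefs :: "nat \<Rightarrow> nat \<Rightarrow> nat" where
  "coefs k i = nth_default 0 (map word_ring_encode (r k)) i"

lemma coefs: "i < n \<Longrightarrow> coefs k i = word_ring_encode (r k ! i)"
  using seq by (simp add: coefs_def computable_word_ring_seq_def nth_default_def)

lemma computable_coefs [computable_intros]:
  assumes "computable k" "computable i"
  shows "computable (\<lambda>x. coefs (k x) (i x))"
proof -
  have "computable (\<lambda>k. list_encode (map word_ring_encode (r k)))"
    using seq unfolding computable_word_ring_seq_def total_computable_iff by blast
  then have "computable (\<lambda>x. nth_default 0 (list_decode (list_encode (map word_ring_encode (r (k x))))) (i x))"
    by (intro computable_intros assms) (rule computable_compose[OF _ assms(1)])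
  then show ?thesis by (simp add: coefs_def)
qed

text \<open>
  \<open>near z k w J\<close> is the \<open>k\<close>-th relation at the group element represented by \<open>w\<close>, tested on
  the first \<open>J\<close> binary digits.
\<close>

definition approx :: "(nat \<Rightarrow> bool) \<Rightarrow> nat \<Rightarrow> nat list \<Rightarrow> nat \<Rightarrow> nat" where
  "approx z k w J = (\<Sum>i<n. \<Sum>b\<in>set_decode (coefs k i). residue_code J (snd (prod_decode b)) *
     btrunc (\<lambda>j. z (idx (w @ list_decode (fst (prod_decode b))) i j)) J)"

text \<open>The tolerance for relation \<open>k\<close>, independent of the number of digits: the
  sum of the absolute values of its coefficients.\<close>

definition coef_norm :: "nat \<Rightarrow> nat" where
  "coef_norm k = (\<Sum>i<n. \<Sum>b\<in>set_decode (coefs k i). abs_code (snd (prod_decode b)))"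

definition near :: "(nat \<Rightarrow> bool) \<Rightarrow> nat \<Rightarrow> nat list \<Rightarrow> nat \<Rightarrow> bool" where
  "near z k w J \<longleftrightarrow> approx z k w J mod 2 ^ J \<le> coef_norm k \<or>
     2 ^ J - approx z k w J mod 2 ^ J \<le> coef_norm k"

text \<open>A crude bound, a sum in place of a maximum, exceeding every position that
  \<open>near\<close> reads.\<close>

definition near_bound :: "nat \<Rightarrow> nat list \<Rightarrow> nat \<Rightarrow> nat" where
  "near_bound k w J = (\<Sum>i<n. \<Sum>b\<in>set_decode (coefs k i).
     \<Sum>j<J. Suc (idx (w @ list_decode (fst (prod_decode b))) i j))"

lemma computable_near:
  "computable (\<lambda>p. near (nth_default False (fst p)) (fst (snd p)) (fst (snd (snd p))) (snd (snd (snd p))))"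
  unfolding near_def approx_def coef_norm_def residue_code_def abs_code_def btrunc_def
  by (intro computable_intros)

lemma computable_near_bound [computable_intros]:
  "computable k \<Longrightarrow> computable w \<Longrightarrow> computable J \<Longrightarrow>
    computable (\<lambda>x. near_bound (k x) (w x) (J x))"
  by (rule computable_compose3[where f = near_bound])
    (unfold near_bound_def, intro computable_intros)

lemma near_cong:
  assumes "\<And>p. p < near_bound k w J \<Longrightarrow> z p = z' p"
  shows "near z k w J = near z' k w J"
proof -
  have "z (idx (w @ list_decode (fst (prod_decode b))) i j) =
      z' (idx (w @ list_decode (fst (prod_decode b))) i j)"
    if "i < n" "b \<in> set_decode (coefs k i)" "j < J" for i b j
  proof (rule assms)
    let ?p = "\<lambda>i b j. Suc (idx (w @ list_decode (fst (prod_decode b))) i j)"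
    have "?p i b j \<le> (\<Sum>j<J. ?p i b j)"
      using that by (intro member_le_sum) auto
    also have "\<dots> \<le> (\<Sum>b\<in>set_decode (coefs k i). \<Sum>j<J. ?p i b j)"
      using that by (intro member_le_sum[of b _ "\<lambda>b. \<Sum>j<J. ?p i b j"]) auto
    also have "\<dots> \<le> near_bound k w J"
      unfolding near_bound_def
      using that by (intro member_le_sum[of i _ "\<lambda>i. \<Sum>b\<in>set_decode (coefs k i). \<Sum>j<J. ?p i b j"]) auto
    finally show "idx (w @ list_decode (fst (prod_decode b))) i j < near_bound k w J" by simp
  qed
  then have "approx z k w J = approx z' k w J"
    unfolding approx_def btrunc_def by (intro sum.cong refl arg_cong2[where f = "(*)"]) auto
  then show ?thesis by (simp add: near_def)
qed

definition cover :: "(nat \<Rightarrow> bool) set" where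
  "cover = {z. (\<forall>w w' i j. val w = val w' \<longrightarrow> z (idx w i j) = z (idx w' i j)) \<and> (\<forall>k w J. near z k w J)}"

lemma cover_cong:
  "z \<in> cover \<Longrightarrow> val w = val w' \<Longrightarrow> z (idx w i j) = z (idx w' i j)"
  unfolding cover_def by blast

lemma effectively_closed_cover:
  assumes "recursively_presented_group G"
  shows "effectively_closed cover"
proof -
  obtain A c where A: "re A" and c: "computable c" and cA: "\<And>w w'. c (w, w') \<in> A \<longleftrightarrow> val w = val w'"
    using computable_word_problem[OF assms s_carrier] by blast
  define c' where "c' t = c (fst t, fst (snd t))" for t :: "nat list \<times> nat list \<times> nat \<times> nat"
  \<comment> \<open>One parameter (w, w', i, j) serves both conditions; in the second, i is the
    index of the relation and j the number of digits. The guard \<open>val w = val w'\<close> does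
    not weaken that condition, since w' = w is allowed.\<close>
  define R where "R z t \<longleftrightarrow> z (idx (fst t) (fst (snd (snd t))) (snd (snd (snd t)))) =
      z (idx (fst (snd t)) (fst (snd (snd t))) (snd (snd (snd t)))) \<and>
      near z (fst (snd (snd t))) (fst t) (snd (snd (snd t)))"
    for z and t :: "nat list \<times> nat list \<times> nat \<times> nat"
  define Q where "Q t = Suc (idx (fst t) (fst (snd (snd t))) (snd (snd (snd t)))) +
      Suc (idx (fst (snd t)) (fst (snd (snd t))) (snd (snd (snd t)))) +
      near_bound (fst (snd (snd t))) (fst t) (snd (snd (snd t)))"
    for t :: "nat list \<times> nat list \<times> nat \<times> nat"
  have "effectively_closed {z. \<forall>t. c' t \<in> A \<longrightarrow> R z t}"
  proof (rule effectively_closed_Collect)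
    show "surj (code :: nat list \<times> nat list \<times> nat \<times> nat \<Rightarrow> nat)"
      by (intro surj_code_prod surj_code_nat surj_code_nat_list)
    show "re A" by (rule A)
    show "computable c'" unfolding c'_def by (intro computable_intros c[THEN computable_compose])
    show "computable Q" unfolding Q_def by (intro computable_intros)
    show "computable (\<lambda>p. R (nth_default False (fst p)) (snd p))"
      unfolding R_def
      by (intro computable_intros computable_compose[OF computable_near,
            of "\<lambda>p. (fst p, fst (snd (snd (snd p))), fst (snd p), snd (snd (snd (snd p))))", simplified])
    show "R z t = R z' t" if "\<And>i. i < Q t \<Longrightarrow> z i = z' i" for t z z'
    proof -
      have "near z (fst (snd (snd t))) (fst t) (snd (snd (snd t))) =
          near z' (fst (snd (snd t))) (fst t) (snd (snd (snd t)))"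
        by (rule near_cong) (simp add: that Q_def)
      then show ?thesis unfolding R_def by (simp add: that Q_def)
    qed
  qed
  also have "{z. \<forall>t. c' t \<in> A \<longrightarrow> R z t} = cover"
    unfolding cover_def c'_def R_def by (auto simp: cA)
  finally show ?thesis .
qed

text \<open>By symmetry of the generating set the inverse of \<open>a\<close> is a letter
  \<open>l\<close>. On \<open>cover\<close> the chosen representative of
  \<open>inv a \<otimes> val w\<close> can be replaced by \<open>l # w\<close>, which turns the map
  into a computable reindexing.\<close>

lemma computable_map_on_generator:
  assumes a: "a \<in> set s"
    and f: "\<And>z w i j. z \<in> cover \<Longrightarrow> f z (idx w i j) = z (idx (word (inv a \<otimes> val w)) i j)"
  shows "computable_map_on cover f"
proof -
  have "inv a \<in> set s" using sym a by (simp add: symmetric_generating_def)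
  then obtain l where l: "l < length s" "s ! l = inv a" by (auto simp: in_set_conv_nth)
  then have val_l: "val (l # w) = inv a \<otimes> val w" for w
    by (simp add: wval_Cons nth_default_def)
  define q where "q p = (let t = (decode p :: nat list \<times> nat \<times> nat)
      in idx (l # fst t) (fst (snd t)) (snd (snd t)))" for p
  have "computable q"
    unfolding q_def Let_def
    by (intro computable_intros surj_code_prod surj_code_nat surj_code_nat_list)
  moreover have "f z = (\<lambda>p. z (q p))" if z: "z \<in> cover" for z
  proof
    fix p
    obtain w i j where p: "p = idx w i j" using ex_idx by blast
    have "val (word (inv a \<otimes> val w)) = val (l # w)"
      using a s_carrier by (subst val_word) (auto simp: val_l)
    then have "z (idx (word (inv a \<otimes> val w)) i j) = z (idx (l # w) i j)"
      by (rule cover_cong[OF z])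
    then show "f z p = z (q p)" using f[OF z] by (simp add: p q_def)
  qed
  ultimately show ?thesis by (rule computable_map_on_reindex)
qed

section \<open>Bits at words versus digits at group elements\<close>

definition spread :: "('a \<Rightarrow> nat \<Rightarrow> nat \<Rightarrow> bool) \<Rightarrow> nat \<Rightarrow> bool" where
  "spread y p = (case decode p of (w, i, j) \<Rightarrow> y (val w) i j)"

definition collect :: "(nat \<Rightarrow> bool) \<Rightarrow> 'a \<Rightarrow> nat \<Rightarrow> nat \<Rightarrow> bool" where
  "collect z g i j = z (idx (word g) i j)"

definition solution :: "('a \<Rightarrow> nat \<Rightarrow> nat \<Rightarrow> bool) \<Rightarrow> bool" where
  "solution y \<longleftrightarrow> (\<forall>k. \<forall>h\<in>carrier G. (\<Sum>i<n. \<Sum>w\<in>Poly_Mapping.keys (r k ! i).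
     of_int (Poly_Mapping.lookup (r k ! i) w) * bval (y (h \<otimes> val w) i)) \<in> \<int>)"

lemma spread_idx [simp]: "spread y (idx w i j) = y (val w) i j"
  by (simp add: spread_def)

lemma collect_spread [simp]: "g \<in> carrier G \<Longrightarrow> collect (spread y) g = y g"
  by (simp add: collect_def fun_eq_iff)

lemma spread_collect: "z \<in> cover \<Longrightarrow> spread (collect z) = z"
proof
  fix p assume z: "z \<in> cover"
  obtain w i j where "p = idx w i j" using ex_idx by blast
  moreover have "z (idx (word (val w)) i j) = z (idx w i j)"
    using z by (rule cover_cong) simp
  ultimately show "spread (collect z) p = z p" by (simp add: collect_def)
qed

lemma spread_cong: "(\<And>h. h \<in> carrier G \<Longrightarrow> y h = y' h) \<Longrightarrow> spread y = spread y'"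
proof
  fix p assume y: "\<And>h. h \<in> carrier G \<Longrightarrow> y h = y' h"
  obtain w i j where "p = idx w i j" using ex_idx by blast
  then show "spread y p = spread y' p" using y by simp
qed

lemma near_spread_iff:
  "(\<forall>J. near (spread y) k w J) \<longleftrightarrow>
    (\<Sum>i<n. \<Sum>v\<in>Poly_Mapping.keys (r k ! i).
      of_int (Poly_Mapping.lookup (r k ! i) v) * bval (y (val w \<otimes> val v) i)) \<in> \<int>"
proof -
  \<comment> \<open>Coordinates and support words are merged into one index set, so that a relation
    becomes a single integer combination of binary expansions.\<close>
  define I where "I = (SIGMA i:{..<n}. Poly_Mapping.keys (r k ! i))"
  define c where "c = (\<lambda>(i, v). Poly_Mapping.lookup (r k ! i) v)"
  define N where "N = (\<lambda>(i, v). btrunc (y (val w \<otimes> val v) i))"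
  define b where "b = (\<lambda>(i, v). bval (y (val w \<otimes> val v) i))"
  have approx: "approx (spread y) k w J = (\<Sum>x\<in>I. residue_code J (int_encode (c x)) * N x J)" for J
  proof -
    have "approx (spread y) k w J = (\<Sum>i<n. \<Sum>b\<in>set_decode (word_ring_encode (r k ! i)).
        residue_code J (snd (prod_decode b)) *
        btrunc (\<lambda>j. spread y (idx (w @ list_decode (fst (prod_decode b))) i j)) J)"
      unfolding approx_def by (intro sum.cong refl) (simp_all add: coefs)
    also have "\<dots> = (\<Sum>i<n. \<Sum>v\<in>Poly_Mapping.keys (r k ! i).
        residue_code J (int_encode (Poly_Mapping.lookup (r k ! i) v)) *
        btrunc (\<lambda>j. spread y (idx (w @ list_decode (list_encode v)) i j)) J)"
      by (intro sum.cong refl sum_set_decode_word_ring_encode[of "\<lambda>a e. residue_code J e *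
        btrunc (\<lambda>j. spread y (idx (w @ list_decode a) _ j)) J"])
    also have "\<dots> = (\<Sum>x\<in>I. residue_code J (int_encode (c x)) * N x J)"
      by (simp add: I_def c_def N_def sum.Sigma val_append split_def)
    finally show ?thesis .
  qed
  \<comment> \<open>The test sees only the residue modulo \<open>2 ^ J\<close>, so nonnegative
    representatives may stand in for the coefficients.\<close>
  have "int (approx (spread y) k w J) mod 2 ^ J = (\<Sum>x\<in>I. c x * int (N x J)) mod 2 ^ J" for J
  proof -
    have "int (approx (spread y) k w J) mod 2 ^ J =
        (\<Sum>x\<in>I. int (residue_code J (int_encode (c x))) * int (N x J)) mod 2 ^ J"
      by (simp only: approx of_nat_sum of_nat_mult)
    also have "\<dots> = (\<Sum>x\<in>I. int (residue_code J (int_encode (c x))) * int (N x J) mod 2 ^ J) mod 2 ^ J"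
      by (rule mod_sum_eq[symmetric])
    also have "\<dots> = (\<Sum>x\<in>I. c x * int (N x J) mod 2 ^ J) mod 2 ^ J"
      by (intro arg_cong2[where f = "(mod)"] sum.cong mod_mult_cong residue_code refl)
    also have "\<dots> = (\<Sum>x\<in>I. c x * int (N x J)) mod 2 ^ J"
      by (rule mod_sum_eq)
    finally show ?thesis .
  qed
  moreover have "int (coef_norm k) = (\<Sum>x\<in>I. \<bar>c x\<bar>)"
  proof -
    have "coef_norm k = (\<Sum>i<n. \<Sum>b\<in>set_decode (word_ring_encode (r k ! i)). abs_code (snd (prod_decode b)))"
      unfolding coef_norm_def by (intro sum.cong refl) (simp_all add: coefs)
    also have "\<dots> = (\<Sum>i<n. \<Sum>v\<in>Poly_Mapping.keys (r k ! i).
        abs_code (int_encode (Poly_Mapping.lookup (r k ! i) v)))"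
      by (intro sum.cong refl sum_set_decode_word_ring_encode[of "\<lambda>_. abs_code"])
    finally show ?thesis by (simp add: abs_code I_def c_def sum.Sigma split_def)
  qed
  ultimately have near: "near (spread y) k w J \<longleftrightarrow>
      near_multiple (2 ^ J) (\<Sum>x\<in>I. \<bar>c x\<bar>) (\<Sum>x\<in>I. c x * int (N x J))" for J
    unfolding near_def near_multiple_of_nat[symmetric] using near_multiple_mod_cong by metis
  have bounds: "real (N x J) \<le> 2 ^ J * b x" "2 ^ J * b x \<le> real (N x J) + 1" for x J
    by (auto simp: N_def b_def split_def intro: bval_bounds)
  have "(\<forall>J. near (spread y) k w J) \<longleftrightarrow> (\<Sum>x\<in>I. of_int (c x) * b x) \<in> \<int>"
    unfolding near by (rule sum_in_Ints_iff_near_multiple[symmetric]) (rule bounds)+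
  also have "(\<Sum>x\<in>I. of_int (c x) * b x) = (\<Sum>i<n. \<Sum>v\<in>Poly_Mapping.keys (r k ! i).
      of_int (Poly_Mapping.lookup (r k ! i) v) * bval (y (val w \<otimes> val v) i))"
    by (simp add: I_def c_def b_def sum.Sigma split_def)
  finally show ?thesis .
qed

text \<open>Agreement at words of equal value is automatic for \<open>spread y\<close>, and testing
  at all words is testing at all group elements.\<close>

lemma spread_in_cover_iff: "spread y \<in> cover \<longleftrightarrow> solution y"
proof -
  have "spread y \<in> cover \<longleftrightarrow> (\<forall>k w. \<forall>J. near (spread y) k w J)"
    by (simp add: cover_def)
  also have "\<dots> \<longleftrightarrow> solution y"
    unfolding near_spread_iff solution_def
  proof (intro iffI allI ballI)
    fix k h
    assume near: "\<forall>k w. (\<Sum>i<n. \<Sum>v\<in>Poly_Mapping.keys (r k ! i).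
        of_int (Poly_Mapping.lookup (r k ! i) v) * bval (y (val w \<otimes> val v) i)) \<in> \<int>"
      and "h \<in> carrier G"
    then show "(\<Sum>i<n. \<Sum>v\<in>Poly_Mapping.keys (r k ! i).
        of_int (Poly_Mapping.lookup (r k ! i) v) * bval (y (h \<otimes> val v) i)) \<in> \<int>"
      using near[rule_format, of k "word h"] by simp
  qed simp
  finally show ?thesis .
qed

lemma solution_collect: "z \<in> cover \<Longrightarrow> solution (collect z)"
  using spread_in_cover_iff[of "collect z"] by (simp add: spread_collect)

text \<open>The shift of digit families, transported to bit sequences. The restriction to
  \<open>cover\<close> makes each map extensional, as membership in \<open>Bij cover\<close>
  demands.\<close>

definition cover_action :: "'a \<Rightarrow> (nat \<Rightarrow> bool) \<Rightarrow> nat \<Rightarrow> bool" where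
  "cover_action g = (\<lambda>z\<in>cover. spread (\<lambda>h. collect z (inv g \<otimes> h)))"

text \<open>Left translation commutes with the right multiplications by \<open>val w\<close> in the
  relations, so it only changes the group element at which a relation is read.\<close>

lemma solution_translate:
  assumes "solution y" "g \<in> carrier G"
  shows "solution (\<lambda>h. y (inv g \<otimes> h))"
  using assms unfolding solution_def by (simp add: m_assoc[symmetric])

lemma cover_action_closed: "g \<in> carrier G \<Longrightarrow> z \<in> cover \<Longrightarrow> cover_action g z \<in> cover"
  by (simp add: cover_action_def spread_in_cover_iff solution_translate solution_collect)

lemma collect_cover_action:
  "g \<in> carrier G \<Longrightarrow> z \<in> cover \<Longrightarrow> h \<in> carrier G \<Longrightarrow>
    collect (cover_action g z) h = collect z (inv g \<otimes> h)"
  by (simp add: cover_action_def)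

lemma cover_action_mult:
  assumes "g \<in> carrier G" "h \<in> carrier G" "z \<in> cover"
  shows "cover_action (g \<otimes> h) z = cover_action g (cover_action h z)"
proof -
  have "cover_action g (cover_action h z) = spread (\<lambda>x. collect (cover_action h z) (inv g \<otimes> x))"
    using assms by (simp add: cover_action_def[of g] cover_action_closed)
  also have "\<dots> = spread (\<lambda>x. collect z (inv (g \<otimes> h) \<otimes> x))"
    using assms by (intro spread_cong) (simp add: collect_cover_action inv_mult_group m_assoc)
  finally show ?thesis using assms by (simp add: cover_action_def)
qed

lemma cover_action_one: "z \<in> cover \<Longrightarrow> cover_action \<one> z = z"
proof -
  assume z: "z \<in> cover"
  have "spread (\<lambda>h. collect z (inv \<one> \<otimes> h)) = spread (collect z)" by (rule spread_cong) simp
  then show ?thesis using z by (simp only: cover_action_def restrict_apply' spread_collect)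
qed

lemma group_action_cover: "group_action G cover cover_action"
proof -
  have "bij_betw (cover_action g) cover cover" if g: "g \<in> carrier G" for g
  proof (rule bij_betw_byWitness[where f' = "cover_action (inv g)"])
    show "\<forall>z\<in>cover. cover_action (inv g) (cover_action g z) = z"
      using g by (simp add: cover_action_mult[symmetric] cover_action_one)
    show "\<forall>z\<in>cover. cover_action g (cover_action (inv g) z) = z"
      using g by (simp add: cover_action_mult[symmetric] cover_action_one)
  qed (auto intro: cover_action_closed simp: g)
  moreover have ext: "cover_action g \<in> extensional cover" for g
    by (simp add: cover_action_def)
  ultimately have "cover_action g \<in> Bij cover" if "g \<in> carrier G" for g
    using that by (simp add: Bij_def)
  moreover have "cover_action (g \<otimes> h) = compose cover (cover_action g) (cover_action h)"
    if "g \<in> carrier G" "h \<in> carrier G" for g h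
    by (rule extensionalityI[of _ cover]) (simp_all add: ext cover_action_mult compose_eq that)
  ultimately have "cover_action \<in> hom G (BijGroup cover)"
    by (auto simp: hom_def BijGroup_def)
  then show ?thesis
    unfolding group_action_def group_hom_def group_hom_axioms_def
    by (simp add: is_group group_BijGroup)
qed

lemma computable_action_cover: "computable_action G cover cover_action"
proof -
  have "computable_map_on cover (cover_action a)" if "a \<in> set s" for a
    using that by (intro computable_map_on_generator) (auto simp: cover_action_def collect_def)
  then show ?thesis
    unfolding computable_action_def using group_action_cover sym
    by (auto simp: symmetric_generating_def intro!: exI[of _ "set s"])
qed

end

section \<open>The factor map\<close>

lemma rmodz_scale_0 [simp]: "rmodz_scale 0 x = 0"
  by transfer simp

lemma rmodz_scale_add: "rmodz_scale (a + b) x = rmodz_scale a x + rmodz_scale b x"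
  by transfer (simp add: distrib_right)

lemma rmodz_scale_abs_rmodz: "rmodz_scale c (abs_rmodz t) = abs_rmodz (of_int c * t)"
  by (simp add: rmodz_scale.abs_eq)

definition rmodz_eval :: "('a \<Rightarrow> rmodz) \<Rightarrow> ('a \<Rightarrow>\<^sub>0 int) \<Rightarrow> rmodz" where
  "rmodz_eval F p = (\<Sum>g\<in>Poly_Mapping.keys p. rmodz_scale (Poly_Mapping.lookup p g) (F g))"

lemma rmodz_eval_superset:
  assumes "finite S" "Poly_Mapping.keys p \<subseteq> S"
  shows "rmodz_eval F p = (\<Sum>g\<in>S. rmodz_scale (Poly_Mapping.lookup p g) (F g))"
  unfolding rmodz_eval_def
  by (rule sum.mono_neutral_left) (use assms in \<open>auto simp: in_keys_iff\<close>)

lemma rmodz_eval_add: "rmodz_eval F (p + q) = rmodz_eval F p + rmodz_eval F q"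
proof -
  define S where "S = Poly_Mapping.keys p \<union> Poly_Mapping.keys q"
  have S: "finite S" "Poly_Mapping.keys p \<subseteq> S" "Poly_Mapping.keys q \<subseteq> S"
      "Poly_Mapping.keys (p + q) \<subseteq> S"
    using keys_add[of p q] by (auto simp: S_def)
  show ?thesis
    by (simp add: rmodz_eval_superset[OF S(1) S(2)] rmodz_eval_superset[OF S(1) S(3)]
        rmodz_eval_superset[OF S(1) S(4)] lookup_add rmodz_scale_add sum.distrib)
qed

lemma rmodz_eval_single: "rmodz_eval F (Poly_Mapping.single g c) = rmodz_scale c (F g)"
  by (subst rmodz_eval_superset[of "{g}"]) auto

lemma rmodz_eval_sum: "rmodz_eval F (\<Sum>i\<in>I. p i) = (\<Sum>i\<in>I. rmodz_eval F (p i))"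
proof (induction I rule: infinite_finite_induct)
  case (insert i I)
  then show ?case by (simp add: rmodz_eval_add)
qed (simp_all add: rmodz_eval_def)

text \<open>Different words may have the same value, and their coefficients may even cancel in the
  group ring. Additivity of \<open>rmodz_eval\<close> makes the sum over words correct all the
  same.\<close>

lemma star_mult_word_ring_value:
  assumes "h \<in> carrier G"
  shows "star_mult G x (word_ring_value G s p) h = (\<Sum>w\<in>Poly_Mapping.keys p.
    rmodz_scale (Poly_Mapping.lookup p w) (x (h \<otimes>\<^bsub>G\<^esub> word_value G s w)))"
proof -
  have "star_mult G x (word_ring_value G s p) h = rmodz_eval (\<lambda>g. x (h \<otimes>\<^bsub>G\<^esub> g)) (word_ring_value G s p)"
    using assms by (simp add: star_mult_def rmodz_eval_def)
  then show ?thesis by (simp add: word_ring_value_def rmodz_eval_sum rmodz_eval_single)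
qed

context presentation
begin

definition circle :: "('a \<Rightarrow> nat \<Rightarrow> nat \<Rightarrow> bool) \<Rightarrow> nat \<Rightarrow> 'a \<Rightarrow> rmodz" where
  "circle y = (\<lambda>i\<in>{..<n}. \<lambda>h\<in>carrier G. abs_rmodz (bval (y h i)))"

lemma circle_in_presented_set_iff: "circle y \<in> presented_set G s n r \<longleftrightarrow> solution y"
proof -
  have "(\<Sum>i<n. star_mult G (circle y i) (word_ring_value G s (r k ! i)) h) =
      abs_rmodz (\<Sum>i<n. \<Sum>w\<in>Poly_Mapping.keys (r k ! i).
        of_int (Poly_Mapping.lookup (r k ! i) w) * bval (y (h \<otimes> val w) i))"
    if h: "h \<in> carrier G" for k h
    unfolding abs_rmodz_sum star_mult_word_ring_value[OF h]
  proof (intro sum.cong refl)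
    fix i w assume i: "i \<in> {..<n}" and w: "w \<in> Poly_Mapping.keys (r k ! i)"
    have "r k ! i \<in> word_ring s"
      using seq i unfolding computable_word_ring_seq_def by (metis lessThan_iff nth_mem subsetD)
    then have "word_value G s w = val w"
      using w by (auto simp: word_ring_def intro: word_value_eq_wval)
    then show "rmodz_scale (Poly_Mapping.lookup (r k ! i) w) (circle y i (h \<otimes> word_value G s w)) =
        abs_rmodz (of_int (Poly_Mapping.lookup (r k ! i) w) * bval (y (h \<otimes> val w) i))"
      using i h by (simp add: circle_def rmodz_scale_abs_rmodz)
  qed
  then show ?thesis
    unfolding presented_set_def solution_def
    by (auto simp: abs_rmodz_eq_0_iff circle_def)
qed

lemma topspace_presented_topology: "topspace (presented_topology G s n r) = presented_set G s n r"
  by (auto simp: presented_topology_def presented_set_def)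

lemma continuous_map_circle_collect:
  "continuous_map (subtopology cantor_space cover) (presented_topology G s n r) (\<lambda>z. circle (collect z))"
  unfolding presented_topology_def continuous_map_in_subtopology
proof
  have "continuous_map (subtopology cantor_space cover) euclidean
      (\<lambda>z. abs_rmodz (bval (collect z h i)))" for h i
    unfolding collect_def[abs_def]
    by (intro continuous_map_from_subtopology continuous_map_bval_rmodz)
  then show "continuous_map (subtopology cantor_space cover)
      (product_topology (\<lambda>_. product_topology (\<lambda>_. euclidean) (carrier G)) {..<n})
      (\<lambda>z. circle (collect z))"
    by (auto simp: continuous_map_componentwise circle_def)
  show "(\<lambda>z. circle (collect z)) \<in> topspace (subtopology cantor_space cover) \<rightarrow> presented_set G s n r"
    by (auto simp: circle_in_presented_set_iff solution_collect)
qed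

lemma circle_collect_image: "(\<lambda>z. circle (collect z)) ` cover = presented_set G s n r"
proof (intro equalityI subsetI)
  fix x assume x: "x \<in> presented_set G s n r"
  have "\<forall>h i. \<exists>y. abs_rmodz (bval y) = x i h" by (simp add: ex_bval_rmodz)
  \<comment> \<open>The expansions may be chosen independently of each other, because membership of
    \<open>spread y\<close> in \<open>cover\<close> depends only on the values
    \<open>bval (y h i)\<close>.\<close>
  then obtain y where y: "\<And>h i. abs_rmodz (bval (y h i)) = x i h" by metis
  have x_eq: "x = circle y"
  proof (rule extensionalityI[of _ "{..<n}"])
    fix i assume i: "i \<in> {..<n}"
    then show "x i = circle y i"
      using x by (intro extensionalityI[of _ "carrier G"]) (auto simp: circle_def y presented_set_def PiE_iff)
  qed (use x in \<open>auto simp: presented_set_def circle_def PiE_iff\<close>)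
  then have "spread y \<in> cover"
    using x by (simp add: spread_in_cover_iff circle_in_presented_set_iff)
  moreover have "circle (collect (spread y)) = circle y"
    by (auto simp: circle_def fun_eq_iff restrict_def)
  ultimately show "x \<in> (\<lambda>z. circle (collect z)) ` cover" using x_eq by force
qed (auto simp: circle_in_presented_set_iff solution_collect)

lemma circle_collect_equivariant:
  assumes g: "g \<in> carrier G" and z: "z \<in> cover"
  shows "circle (collect (cover_action g z)) = presented_action G n g (circle (collect z))"
  unfolding circle_def presented_action_def shift_def
  by (intro restrict_ext) (simp add: collect_cover_action[OF g z] g restrict_def cong: if_cong)

lemma topological_factor_cover:
  "topological_factor G (subtopology cantor_space cover) cover_action
    (presented_topology G s n r) (presented_action G n)"
  unfolding topological_factor_def
proof (intro exI conjI ballI)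
  have top: "topspace (subtopology cantor_space cover) = cover"
    by (simp add: cantor_space_eq_euclidean)
  show "continuous_map (subtopology cantor_space cover) (presented_topology G s n r) (\<lambda>z. circle (collect z))"
    by (rule continuous_map_circle_collect)
  show "(\<lambda>z. circle (collect z)) ` topspace (subtopology cantor_space cover) = topspace (presented_topology G s n r)"
    unfolding top topspace_presented_topology by (rule circle_collect_image)
  show "circle (collect (cover_action g z)) = presented_action G n g (circle (collect z))"
    if "g \<in> carrier G" "z \<in> topspace (subtopology cantor_space cover)" for g z
    using that circle_collect_equivariant unfolding top by blast
qed

end

lemma topological_factor_trans:
  assumes "topological_factor G X actX Y actY" "topological_factor G Y actY Z actZ"
  shows "topological_factor G X actX Z actZ"
proof -
  obtain f where f: "continuous_map X Y f" "f ` topspace X = topspace Y"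
      "\<And>g x. g \<in> carrier G \<Longrightarrow> x \<in> topspace X \<Longrightarrow> f (actX g x) = actY g (f x)"
    using assms(1) unfolding topological_factor_def by blast
  obtain f' where f': "continuous_map Y Z f'" "f' ` topspace Y = topspace Z"
      "\<And>g y. g \<in> carrier G \<Longrightarrow> y \<in> topspace Y \<Longrightarrow> f' (actY g y) = actZ g (f' y)"
    using assms(2) unfolding topological_factor_def by blast
  have "(f' \<circ> f) (actX g x) = actZ g ((f' \<circ> f) x)" if "g \<in> carrier G" "x \<in> topspace X" for g x
    using that f(2,3) f'(3) by (metis comp_apply imageI)
  moreover have "(f' \<circ> f) ` topspace X = topspace Z" using f(2) f'(2) by (metis image_comp)
  ultimately show ?thesis
    unfolding topological_factor_def using continuous_map_compose[OF f(1) f'(1)] by blast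
qed

text \<open>The factor map is the inverse homeomorphism; its equivariance follows by applying it to
  that of the isomorphism, which needs \<open>act g\<close> to stay in the carrier.\<close>

lemma topological_factor_of_iso:
  assumes iso: "algebraic_action_iso G X T act X' T' act'"
    and top: "topspace T = carrier X"
    and closed: "\<And>g x. g \<in> carrier G \<Longrightarrow> x \<in> carrier X \<Longrightarrow> act g x \<in> carrier X"
  shows "topological_factor G T' act' T act"
proof -
  obtain \<phi> where "homeomorphic_map T T' \<phi>"
      and equiv: "\<And>g x. g \<in> carrier G \<Longrightarrow> x \<in> carrier X \<Longrightarrow> \<phi> (act g x) = act' g (\<phi> x)"
    using iso unfolding algebraic_action_iso_def by blast
  then obtain \<psi> where \<psi>: "homeomorphic_maps T T' \<phi> \<psi>"
    by (auto simp: homeomorphic_map_maps)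
  then have maps: "continuous_map T T' \<phi>" "continuous_map T' T \<psi>"
      "\<And>x. x \<in> topspace T \<Longrightarrow> \<psi> (\<phi> x) = x" "\<And>y. y \<in> topspace T' \<Longrightarrow> \<phi> (\<psi> y) = y"
    by (auto simp: homeomorphic_maps_def)
  have image: "\<psi> ` topspace T' = topspace T"
    using homeomorphic_imp_surjective_map[of T' T \<psi>] \<psi> homeomorphic_maps_map by blast
  have "\<psi> (act' g y) = act g (\<psi> y)" if "g \<in> carrier G" "y \<in> topspace T'" for g y
  proof -
    have "\<psi> y \<in> carrier X" using image that top by auto
    then have "\<psi> (act' g (\<phi> (\<psi> y))) = act g (\<psi> y)"
      using equiv[OF that(1), of "\<psi> y"] maps(3)[of "act g (\<psi> y)"] closed[OF that(1)] top by simp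
    then show ?thesis using maps(4)[OF that(2)] by simp
  qed
  then show ?thesis unfolding topological_factor_def using maps(2) image by blast
qed

theorem corollary6p7:
  fixes G :: "('g, 'm) monoid_scheme"
    and X :: "('x, 'n) monoid_scheme"
    and T :: "'x topology"
    and act :: "'g \<Rightarrow> 'x \<Rightarrow> 'x"
  assumes "group G"
    and "finitely_generated_group G"
    and "recursively_presented_group G"
    and "self_simulable G"
    and "recursively_presented_action G X T act"
  shows "factor_of_SFT G T act"
proof -
  obtain s n r where action: "algebraic_action G X T act"
      and sym: "symmetric_generating G s" and seq: "computable_word_ring_seq s n r"
      and iso: "algebraic_action_iso G X T act
          (presented_group G s n r) (presented_topology G s n r) (presented_action G n)"
    using assms(5) unfolding recursively_presented_action_def by blast
  interpret presentation G s n r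
    using assms(1) sym seq by (simp add: presentation_def presentation_axioms_def)
  have "factor_of_SFT G (subtopology cantor_space cover) cover_action"
    using assms(4) effectively_closed_cover[OF assms(3)] computable_action_cover
    unfolding self_simulable_def by blast
  then obtain A :: "nat set" and Y where "SFT G A Y"
    and Y: "topological_factor G (subtopology (full_shift G A) Y) (shift G)
      (subtopology cantor_space cover) cover_action"
    unfolding factor_of_SFT_def by blast
  moreover have "act g x \<in> carrier X" if "g \<in> carrier G" "x \<in> carrier X" for g x
    using action that unfolding algebraic_action_def by (blast intro: group_action.element_image)
  then have "topological_factor G (presented_topology G s n r) (presented_action G n) T act"
    using action by (intro topological_factor_of_iso[OF iso])
      (auto simp: algebraic_action_def compact_metrizable_abelian_group_def)
  then have "topological_factor G (subtopology (full_shift G A) Y) (shift G) T act"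
    by (rule topological_factor_trans[OF topological_factor_trans[OF Y topological_factor_cover]])
  ultimately show ?thesis unfolding factor_of_SFT_def by blast
qed

end
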